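(* Let $(X,\tau)$ be an involutive space with $X$ compact, path-connected, Hausdorff and admitting a $\mathbb Z_2$-CW complex structure. For every $m\in\mathbb N$, every rank $2m$ $\mathfrak Q$-bundle over $(X,\tau)$ is $\mathfrak Q$-isomorphic to $\varphi^*\mathbb T^\infty_{2m}$ for some equivariant map $\varphi:X\to G_{2m}(\mathbb C^\infty)$ (i.e. $\varphi\circ\tau=\rho\circ\varphi$), and this induces a bijection $$\mathrm{Vec}^{2m}_{\mathfrak Q}(X,\tau)\cong[X,\hat G_{2m}(\mathbb C^\infty)]_{\mathbb Z_2}.$$
   Context: A "Quaternionic" vector bundle ($\mathfrak Q$-bundle) over an involutive space $(X,\tau)$ ($\tau^2=\mathrm{Id}$) is a complex vector bundle $\pi:E\to X$ with a homeomorphism $\Theta:E\to E$ such that $\pi\circ\Theta=\tau\circ\pi$, $\Theta$ antilinear $E_x\to E_{\tau(x)}$, $\Theta^2=-1$ fiberwise; $\mathrm{Vec}^{n}_{\mathfrak Q}(X,\tau)$ is the set of isomorphism classes (isomorphisms commuting with $\Theta$) of rank $n$ ones. A $\mathbb Z_2$-CW complex is built by attaching cells $\mathbb Z_2/H\times D^k$ equivariantly. $G_{2m}(\mathbb C^\infty)=\bigcup_n G_{2m}(\mathbb C^{2n})$ is the Grassmannian of $2m$-planes with the direct limit topology; $\rho$ is the involution $\rho(\langle v_1,\dots,v_{2m}\rangle)=\langle Q\bar v_1,\dots,Q\bar v_{2m}\rangle$, $Q$ being the block diagonal matrix (of the appropriate size) with blocks $\begin{pmatrix}0&-1\\1&0\end{pmatrix}$,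 and $\hat G_{2m}(\mathbb C^\infty)=(G_{2m}(\mathbb C^\infty),\rho)$. $\mathbb T^\infty_{2m}=\{(\Sigma,v):v\in\Sigma\}$ is the tautological bundle with $\mathfrak Q$-structure $\Xi(\Sigma,v)=(\rho(\Sigma),Q\bar v)$. $[X,Y]_{\mathbb Z_2}$ denotes classes of equivariant maps up to equivariant homotopy; the pullback $\varphi^*\mathbb T^\infty_{2m}$ carries the induced $\mathfrak Q$-structure. *)

theory Defs
  imports "HOL-Analysis.Analysis"
begin

definition final_top_pred ::
  "'b set \<Rightarrow> (nat \<Rightarrow> 'c topology) \<Rightarrow> (nat \<Rightarrow> 'c \<Rightarrow> 'b) \<Rightarrow> 'b set \<Rightarrow> bool" where
  "final_top_pred S T f U \<longleftrightarrow>
     U \<subseteq> S \<and> (\<forall>N. openin (T N) {x \<in> topspace (T N). f N x \<in> U})"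

lemma istopology_final_top_pred: "istopology (final_top_pred S T f)"
  unfolding istopology_def final_top_pred_def
proof (intro conjI allI impI ballI)
  fix U V N
  assume "U \<subseteq> S \<and> (\<forall>N. openin (T N) {x \<in> topspace (T N). f N x \<in> U})"
     and "V \<subseteq> S \<and> (\<forall>N. openin (T N) {x \<in> topspace (T N). f N x \<in> V})"
  then show "U \<inter> V \<subseteq> S" by blast
  from \<open>U \<subseteq> S \<and> _\<close> \<open>V \<subseteq> S \<and> _\<close>
  have "openin (T N) ({x \<in> topspace (T N). f N x \<in> U} \<inter> {x \<in> topspace (T N). f N x \<in> V})"
    by blast
  moreover have "{x \<in> topspace (T N). f N x \<in> U \<inter> V} =
      {x \<in> topspace (T N). f N x \<in> U} \<inter> {x \<in> topspace (T N). f N x \<in> V}" by blast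
  ultimately show "openin (T N) {x \<in> topspace (T N). f N x \<in> U \<inter> V}" by simp
next
  fix K N
  assume K: "\<forall>U\<in>K. U \<subseteq> S \<and> (\<forall>N. openin (T N) {x \<in> topspace (T N). f N x \<in> U})"
  then show "\<Union>K \<subseteq> S" by blast
  have "openin (T N) (\<Union>U\<in>K. {x \<in> topspace (T N). f N x \<in> U})"
    using K by blast
  moreover have "{x \<in> topspace (T N). f N x \<in> \<Union>K} = (\<Union>U\<in>K. {x \<in> topspace (T N). f N x \<in> U})"
    by blast
  ultimately show "openin (T N) {x \<in> topspace (T N). f N x \<in> \<Union>K}" by simp
qed

definition final_top ::
  "'b set \<Rightarrow> (nat \<Rightarrow> 'c topology) \<Rightarrow> (nat \<Rightarrow> 'c \<Rightarrow> 'b) \<Rightarrow> 'b topology" where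
  "final_top S T f = topology (final_top_pred S T f)"

text \<open>C^n is realised as the sequences nat => complex vanishing from index n on,
  with the (product = Euclidean) topology.\<close>
definition cvec :: "nat \<Rightarrow> (nat \<Rightarrow> complex) set" where
  "cvec n = {v. \<forall>i\<ge>n. v i = 0}"

definition cvec_top :: "nat \<Rightarrow> (nat \<Rightarrow> complex) topology" where
  "cvec_top n = top_of_set (cvec n)"

definition cinf :: "(nat \<Rightarrow> complex) set" where
  "cinf = (\<Union>n. cvec n)"

definition cinf_top :: "(nat \<Rightarrow> complex) topology" where
  "cinf_top = final_top cinf cvec_top (\<lambda>N v. v)"

definition cspan :: "nat \<Rightarrow> (nat \<Rightarrow> nat \<Rightarrow> complex) \<Rightarrow> (nat \<Rightarrow> complex) set" where
  "cspan k vs = {(\<lambda>i. \<Sum>j<k. c j * vs j i) | c. True}"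

definition cindep :: "nat \<Rightarrow> (nat \<Rightarrow> nat \<Rightarrow> complex) \<Rightarrow> bool" where
  "cindep k vs \<longleftrightarrow> (\<forall>c. (\<lambda>i. \<Sum>j<k. c j * vs j i) = (\<lambda>i. 0) \<longrightarrow> (\<forall>j<k. c j = 0))"

definition stiefel :: "nat \<Rightarrow> nat \<Rightarrow> (nat \<Rightarrow> nat \<Rightarrow> complex) set" where
  "stiefel k N = {vs. (\<forall>j. \<forall>i. (j \<ge> k \<or> i \<ge> N) \<longrightarrow> vs j i = 0) \<and> cindep k vs}"

definition stiefel_top :: "nat \<Rightarrow> nat \<Rightarrow> (nat \<Rightarrow> nat \<Rightarrow> complex) topology" where
  "stiefel_top k N = top_of_set (stiefel k N)"

definition grass :: "nat \<Rightarrow> nat \<Rightarrow> (nat \<Rightarrow> complex) set set" where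
  "grass k N = cspan k ` stiefel k N"

definition grass_inf :: "nat \<Rightarrow> (nat \<Rightarrow> complex) set set" where
  "grass_inf k = (\<Union>N. grass k N)"

text \<open>Topology: G_k(C^N) carries the quotient topology from the Stiefel space, and
  G_k(C^\<infinity>) the direct limit topology; both at once as a final topology.\<close>
definition grass_top :: "nat \<Rightarrow> (nat \<Rightarrow> complex) set topology" where
  "grass_top k = final_top (grass_inf k) (stiefel_top k) (\<lambda>N. cspan k)"

text \<open>The matrix Q (blocks ((0,-1),(1,0))), acting on C^\<infinity>, and the involution rho.\<close>
definition Qmap :: "(nat \<Rightarrow> complex) \<Rightarrow> (nat \<Rightarrow> complex)" where
  "Qmap v = (\<lambda>i. if even i then - v (Suc i) else v (i - 1))"

definition Qconj :: "(nat \<Rightarrow> complex) \<Rightarrow> (nat \<Rightarrow> complex)" where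
  "Qconj v = Qmap (\<lambda>i. cnj (v i))"

definition rho :: "(nat \<Rightarrow> complex) set \<Rightarrow> (nat \<Rightarrow> complex) set" where
  "rho S = Qconj ` S"

definition involution :: "'a topology \<Rightarrow> ('a \<Rightarrow> 'a) \<Rightarrow> bool" where
  "involution X \<tau> \<longleftrightarrow> continuous_map X X \<tau> \<and> (\<forall>x\<in>topspace X. \<tau> (\<tau> x) = x)"

definition cvb :: "'a topology \<Rightarrow> nat \<Rightarrow> 'e topology \<Rightarrow> ('e \<Rightarrow> 'a) \<Rightarrow>
    ('e \<Rightarrow> 'e \<Rightarrow> 'e) \<Rightarrow> (complex \<Rightarrow> 'e \<Rightarrow> 'e) \<Rightarrow> bool" where
  "cvb X n E p add sc \<longleftrightarrow>
     continuous_map E X p \<and>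
     (\<forall>e\<in>topspace E. \<forall>f\<in>topspace E. p e = p f \<longrightarrow>
         add e f \<in> topspace E \<and> p (add e f) = p e) \<and>
     (\<forall>c. \<forall>e\<in>topspace E. sc c e \<in> topspace E \<and> p (sc c e) = p e) \<and>
     (\<forall>x\<in>topspace X. \<exists>U h. openin X U \<and> x \<in> U \<and>
        homeomorphic_map (subtopology E {e \<in> topspace E. p e \<in> U})
                         (prod_topology (subtopology X U) (cvec_top n)) h \<and>
        (\<forall>e\<in>topspace E. p e \<in> U \<longrightarrow> fst (h e) = p e) \<and>
        (\<forall>e\<in>topspace E. \<forall>f\<in>topspace E. p e \<in> U \<longrightarrow> p f = p e \<longrightarrow>
            snd (h (add e f)) = (\<lambda>i. snd (h e) i + snd (h f) i)) \<and>
        (\<forall>c. \<forall>e\<in>topspace E. p e \<in> U \<longrightarrow>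
            snd (h (sc c e)) = (\<lambda>i. c * snd (h e) i)))"

definition qbundle :: "'a topology \<Rightarrow> ('a \<Rightarrow> 'a) \<Rightarrow> nat \<Rightarrow> 'e topology \<Rightarrow> ('e \<Rightarrow> 'a) \<Rightarrow>
    ('e \<Rightarrow> 'e \<Rightarrow> 'e) \<Rightarrow> (complex \<Rightarrow> 'e \<Rightarrow> 'e) \<Rightarrow> ('e \<Rightarrow> 'e) \<Rightarrow> bool" where
  "qbundle X \<tau> n E p add sc \<Theta> \<longleftrightarrow>
     involution X \<tau> \<and> cvb X n E p add sc \<and>
     homeomorphic_map E E \<Theta> \<and>
     (\<forall>e\<in>topspace E. p (\<Theta> e) = \<tau> (p e)) \<and>
     (\<forall>e\<in>topspace E. \<forall>f\<in>topspace E. p e = p f \<longrightarrow> \<Theta> (add e f) = add (\<Theta> e) (\<Theta> f)) \<and>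
     (\<forall>c. \<forall>e\<in>topspace E. \<Theta> (sc c e) = sc (cnj c) (\<Theta> e)) \<and>
     (\<forall>e\<in>topspace E. \<Theta> (\<Theta> e) = sc (-1) e)"

definition qiso :: "'e topology \<Rightarrow> ('e \<Rightarrow> 'a) \<Rightarrow> ('e \<Rightarrow> 'e \<Rightarrow> 'e) \<Rightarrow> (complex \<Rightarrow> 'e \<Rightarrow> 'e) \<Rightarrow> ('e \<Rightarrow> 'e) \<Rightarrow>
    'f topology \<Rightarrow> ('f \<Rightarrow> 'a) \<Rightarrow> ('f \<Rightarrow> 'f \<Rightarrow> 'f) \<Rightarrow> (complex \<Rightarrow> 'f \<Rightarrow> 'f) \<Rightarrow> ('f \<Rightarrow> 'f) \<Rightarrow> bool" where
  "qiso E p add sc \<Theta> E' p' add' sc' \<Theta>' \<longleftrightarrow>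
     (\<exists>g. homeomorphic_map E E' g \<and>
        (\<forall>e\<in>topspace E. p' (g e) = p e) \<and>
        (\<forall>e\<in>topspace E. \<forall>f\<in>topspace E. p e = p f \<longrightarrow> g (add e f) = add' (g e) (g f)) \<and>
        (\<forall>c. \<forall>e\<in>topspace E. g (sc c e) = sc' c (g e)) \<and>
        (\<forall>e\<in>topspace E. g (\<Theta> e) = \<Theta>' (g e)))"

text \<open>phi^* T^\<infinity>_k: total space {(x,v). v \<in> phi x} \<subseteq> X \<times> C^\<infinity> (the redundant
  Grassmannian coordinate phi x is omitted), with Q-structure (x,v) \<mapsto> (tau x, Q conj v).\<close>
definition pb_top :: "'a topology \<Rightarrow> ('a \<Rightarrow> (nat \<Rightarrow> complex) set) \<Rightarrow> ('a \<times> (nat \<Rightarrow> complex)) topology" where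
  "pb_top X \<phi> = subtopology (prod_topology X cinf_top) {(x, v). x \<in> topspace X \<and> v \<in> \<phi> x}"

definition pb_add :: "'a \<times> (nat \<Rightarrow> complex) \<Rightarrow> 'a \<times> (nat \<Rightarrow> complex) \<Rightarrow> 'a \<times> (nat \<Rightarrow> complex)" where
  "pb_add e f = (fst e, \<lambda>i. snd e i + snd f i)"

definition pb_sc :: "complex \<Rightarrow> 'a \<times> (nat \<Rightarrow> complex) \<Rightarrow> 'a \<times> (nat \<Rightarrow> complex)" where
  "pb_sc c e = (fst e, \<lambda>i. c * snd e i)"

definition pb_Theta :: "('a \<Rightarrow> 'a) \<Rightarrow> 'a \<times> (nat \<Rightarrow> complex) \<Rightarrow> 'a \<times> (nat \<Rightarrow> complex)" where
  "pb_Theta \<tau> e = (\<tau> (fst e), Qconj (snd e))"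

definition equivariant_grass :: "'a topology \<Rightarrow> ('a \<Rightarrow> 'a) \<Rightarrow> nat \<Rightarrow> ('a \<Rightarrow> (nat \<Rightarrow> complex) set) \<Rightarrow> bool" where
  "equivariant_grass X \<tau> k \<phi> \<longleftrightarrow>
     continuous_map X (grass_top k) \<phi> \<and> (\<forall>x\<in>topspace X. \<phi> (\<tau> x) = rho (\<phi> x))"

definition disk :: "nat \<Rightarrow> (nat \<Rightarrow> real) set" where
  "disk n = {v. (\<forall>i\<ge>n. v i = 0) \<and> (\<Sum>i<n. (v i)\<^sup>2) \<le> 1}"

definition odisk :: "nat \<Rightarrow> (nat \<Rightarrow> real) set" where
  "odisk n = {v. (\<forall>i\<ge>n. v i = 0) \<and> (\<Sum>i<n. (v i)\<^sup>2) < 1}"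

definition sphere :: "nat \<Rightarrow> (nat \<Rightarrow> real) set" where
  "sphere n = {v. (\<forall>i\<ge>n. v i = 0) \<and> (\<Sum>i<n. (v i)\<^sup>2) = 1}"

text \<open>A CW structure: open cells C (a partition of X), dimension d e and characteristic
  maps Phi e : D^(d e) -> X (mapping the open disk homeomorphically onto e, the boundary
  sphere into cells of lower dimension), closure-finite, with the weak topology.
  Equivariance: tau permutes cells; a cell is either fixed pointwise with tau o Phi e = Phi e
  (cell Z2/Z2 \<times> D^n) or moved to a different cell with characteristic map tau o Phi e
  (cell Z2 \<times> D^n).\<close>
definition Z2_CW :: "'a topology \<Rightarrow> ('a \<Rightarrow> 'a) \<Rightarrow> 'a set set \<Rightarrow> ('a set \<Rightarrow> nat) \<Rightarrow>
    ('a set \<Rightarrow> (nat \<Rightarrow> real) \<Rightarrow> 'a) \<Rightarrow> bool" where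
  "Z2_CW X \<tau> C d \<Phi> \<longleftrightarrow>
     \<Union>C = topspace X \<and> {} \<notin> C \<and> pairwise disjnt C \<and>
     (\<forall>e\<in>C. continuous_map (top_of_set (disk (d e))) X (\<Phi> e) \<and>
        homeomorphic_map (top_of_set (odisk (d e))) (subtopology X e) (\<Phi> e) \<and>
        \<Phi> e ` sphere (d e) \<subseteq> \<Union>{e'\<in>C. d e' < d e}) \<and>
     (\<forall>e\<in>C. finite {e'\<in>C. e' \<inter> X closure_of e \<noteq> {}}) \<and>
     (\<forall>A. A \<subseteq> topspace X \<longrightarrow>
        (closedin X A \<longleftrightarrow> (\<forall>e\<in>C. closedin X (A \<inter> X closure_of e)))) \<and>
     (\<forall>e\<in>C. \<tau> ` e \<in> C \<and>
        ((\<tau> ` e = e \<and> (\<forall>v\<in>disk (d e). \<tau> (\<Phi> e v) = \<Phi> e v)) \<or>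
         (\<tau> ` e \<noteq> e \<and> d (\<tau> ` e) = d e \<and> (\<forall>v\<in>disk (d e). \<Phi> (\<tau> ` e) v = \<tau> (\<Phi> e v)))))"

definition has_Z2_CW_structure :: "'a topology \<Rightarrow> ('a \<Rightarrow> 'a) \<Rightarrow> bool" where
  "has_Z2_CW_structure X \<tau> \<longleftrightarrow> (\<exists>C d \<Phi>. Z2_CW X \<tau> C d \<Phi>)"

end

(* Compactness of X puts every map X -> G(C^infinity), and every homotopy of such maps, into a
   finite stage G(C^(2N)). Orthogonal projections provide continuous local frames there, which
   gives the local triviality of pull-backs.

   Surjectivity: cut-off local trivialisations add up to a fibrewise linear injection g of the
   bundle into some C^N, and e |-> (g(e), -conj(g(Theta e))), with interleaved coordinates, is
   equivariant for v |-> Q conj(v); the classifying map sends x to the image of the fibre over x.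

   Homotopic maps: for nearby times the orthogonal projection onto the second subspace, restricted
   to the first, is an isomorphism commuting with the Q-structures; a tube argument and the
   connectedness of [0,1] finish this direction.

   Isomorphic pull-backs: if g is the isomorphism and S shifts C^(2N) by 2N coordinates, then the
   maps (1-t) v + t S(g v) are injective on each fibre, so phi is homotopic to S psi, and in the
   same way so is psi. *)

theory Submission
  imports Defs "Jordan_Normal_Form.Determinant"
begin

section \<open>Square arrays and continuous maps into euclidean spaces\<close>

text \<open>The direct limit topologies shape the proof: total spaces and homotopies live in
  products with a direct limit, and such a product is in general not the direct limit of the
  products. Inside one finite stage a total space is a subspace of \<open>X\<close> times a
  Euclidean sequence space, so continuity becomes a matter of single coordinates. Frames are
  linearly independent but not orthonormal. Coordinates in a frame come from the inverse of its Gram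
  matrix, written as adjugate over determinant; every entry is a rational expression in the entries
  of the frame and their conjugates, hence continuous. This one formula yields the coordinates of
  local trivialisations, the continuity of the orthogonal projection in the subspace and, since
  projections separate subspaces, the Hausdorff property on which the compactness argument rests.
  Even stages are singled out because Q couples the coordinates 2j and 2j+1.\<close>

definition arr_det :: "nat \<Rightarrow> (nat \<Rightarrow> nat \<Rightarrow> complex) \<Rightarrow> complex" where
  "arr_det K A = Determinant.det (Matrix.mat K K (\<lambda>(i,j). A i j))"

text \<open>Frames are functions of two indices, of which only the entries below \<open>K\<close>
  matter here. The adjugate over the determinant is the inverse, with the numerator polynomial in
  the entries.\<close>

definition arr_adj :: "nat \<Rightarrow> (nat \<Rightarrow> nat \<Rightarrow> complex) \<Rightarrow> nat \<Rightarrow> nat \<Rightarrow> complex" where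
  "arr_adj K A i j = adj_mat (Matrix.mat K K (\<lambda>(i,j). A i j)) $$ (i,j)"

lemma arr_adj_left:
  assumes "i < K" "j < K"
  shows "(\<Sum>l<K. arr_adj K A i l * A l j) = (if i = j then arr_det K A else 0)"
proof -
  let ?M = "Matrix.mat K K (\<lambda>(i,j). A i j)"
  have M: "?M \<in> carrier_mat K K" by simp
  have "(adj_mat ?M * ?M) $$ (i,j) = (\<Sum>l<K. arr_adj K A i l * A l j)"
    using assms adj_mat(1)[OF M]
    by (auto simp: times_mat_def scalar_prod_def arr_adj_def lessThan_atLeast0 intro!: sum.cong)
  then show ?thesis using adj_mat(3)[OF M] assms by (auto simp: arr_det_def split: if_splits)
qed

lemma arr_adj_right:
  assumes "i < K" "j < K"
  shows "(\<Sum>l<K. A i l * arr_adj K A l j) = (if i = j then arr_det K A else 0)"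
proof -
  let ?M = "Matrix.mat K K (\<lambda>(i,j). A i j)"
  have M: "?M \<in> carrier_mat K K" by simp
  have "(?M * adj_mat ?M) $$ (i,j) = (\<Sum>l<K. A i l * arr_adj K A l j)"
    using assms adj_mat(1)[OF M]
    by (auto simp: times_mat_def scalar_prod_def arr_adj_def lessThan_atLeast0 intro!: sum.cong)
  then show ?thesis using adj_mat(2)[OF M] assms by (auto simp: arr_det_def split: if_splits)
qed

text \<open>Independence of a frame concerns combinations of rows, while the kernel vector of a
  singular matrix combines columns; hence the passage to the transpose.\<close>

lemma arr_det_nonzero:
  assumes "\<And>c. (\<And>i. i < K \<Longrightarrow> (\<Sum>j<K. c j * A j i) = 0) \<Longrightarrow> (\<forall>j<K. c j = 0)"
  shows "arr_det K A \<noteq> 0"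
proof
  assume d: "arr_det K A = 0"
  let ?M = "Matrix.mat K K (\<lambda>(i,j). A i j)"
  let ?T = "transpose_mat ?M"
  have T: "?T \<in> carrier_mat K K" by simp
  have "Determinant.det ?T = 0"
    using d Determinant.det_transpose[of ?M K] by (simp add: arr_det_def)
  then obtain v where v: "v \<in> carrier_vec K" "v \<noteq> 0\<^sub>v K" "?T *\<^sub>v v = 0\<^sub>v K"
    using det_0_iff_vec_prod_zero[OF T] by blast
  have "(\<Sum>j<K. vec_index v j * A j i) = 0" if "i < K" for i
  proof -
    have "vec_index (?T *\<^sub>v v) i = (\<Sum>j<K. vec_index v j * A j i)"
      using that v(1) by (auto simp: scalar_prod_def lessThan_atLeast0 mult.commute intro!: sum.cong)
    then show ?thesis using v(3) that by simp
  qed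
  then have "\<forall>j<K. vec_index v j = 0" using assms[of "vec_index v"] by blast
  then have "v = 0\<^sub>v K" using v(1) by auto
  then show False using v(2) by simp
qed

section \<open>Continuity of arithmetic, determinants and adjugates\<close>

text \<open>Turns continuity on an abstract topology into limits, to which the
  \<open>tendsto\<close> calculus applies.\<close>

lemma continuous_map_euclidean_iff:
  "continuous_map X euclidean f \<longleftrightarrow> (\<forall>x\<in>topspace X. (f \<longlongrightarrow> f x) (atin X x))"
  by (simp add: continuous_map_atin)

lemma continuous_map_mult_complex:
  fixes f g :: "'a \<Rightarrow> complex"
  assumes "continuous_map X euclidean f" "continuous_map X euclidean g"
  shows "continuous_map X euclidean (\<lambda>x. f x * g x)"
  using assms by (auto simp: continuous_map_euclidean_iff intro!: tendsto_intros)

lemma continuous_map_divide_complex: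
  fixes f g :: "'a \<Rightarrow> complex"
  assumes "continuous_map X euclidean f" "continuous_map X euclidean g"
    and "\<And>x. x \<in> topspace X \<Longrightarrow> g x \<noteq> 0"
  shows "continuous_map X euclidean (\<lambda>x. f x / g x)"
  using assms by (auto simp: continuous_map_euclidean_iff intro!: tendsto_intros)

lemma continuous_map_cnj:
  "continuous_map X euclidean f \<Longrightarrow> continuous_map X euclidean (\<lambda>x. cnj (f x))"
  by (auto simp: continuous_map_euclidean_iff intro!: tendsto_intros)

lemma continuous_map_add_complex:
  fixes f g :: "'a \<Rightarrow> complex"
  assumes "continuous_map X euclidean f" "continuous_map X euclidean g"
  shows "continuous_map X euclidean (\<lambda>x. f x + g x)"
  using assms by (auto simp: continuous_map_euclidean_iff intro!: tendsto_intros)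

lemma continuous_map_uminus_complex:
  fixes f :: "'a \<Rightarrow> complex"
  assumes "continuous_map X euclidean f"
  shows "continuous_map X euclidean (\<lambda>x. - f x)"
  using assms by (auto simp: continuous_map_euclidean_iff intro!: tendsto_intros)

lemma continuous_map_sum_complex:
  fixes f :: "'i \<Rightarrow> 'a \<Rightarrow> complex"
  assumes "\<And>i. i \<in> I \<Longrightarrow> continuous_map X euclidean (f i)"
  shows "continuous_map X euclidean (\<lambda>x. \<Sum>i\<in>I. f i x)"
  using assms by (auto simp: continuous_map_euclidean_iff intro!: tendsto_intros)

lemma continuous_map_prod_complex:
  fixes f :: "'i \<Rightarrow> 'a \<Rightarrow> complex"
  assumes "\<And>i. i \<in> I \<Longrightarrow> continuous_map X euclidean (f i)"
  shows "continuous_map X euclidean (\<lambda>x. \<Prod>i\<in>I. f i x)"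
  using assms by (auto simp: continuous_map_euclidean_iff intro!: tendsto_intros)

lemma continuous_map_of_real:
  "continuous_map X euclidean f \<Longrightarrow> continuous_map X euclidean (\<lambda>x. complex_of_real (f x))"
  by (auto simp: continuous_map_euclidean_iff intro!: tendsto_intros)

lemma continuous_map_constant: "continuous_map X euclidean (\<lambda>x. c)"
  by simp

lemmas cmap_intros = continuous_map_mult_complex continuous_map_divide_complex continuous_map_cnj
  continuous_map_add_complex continuous_map_uminus_complex continuous_map_sum_complex
  continuous_map_prod_complex continuous_map_of_real continuous_map_constant

lemma continuous_map_into_seq_iff:
  fixes f :: "'a \<Rightarrow> nat \<Rightarrow> 'b :: topological_space"
  shows "continuous_map X euclidean f \<longleftrightarrow> (\<forall>i. continuous_map X euclidean (\<lambda>x. f x i))"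
  by (simp add: euclidean_product_topology continuous_map_componentwise_UNIV
      flip: euclidean_product_topology)

lemma continuous_map_locally:
  assumes "\<And>x. x \<in> topspace X \<Longrightarrow> \<exists>U. openin X U \<and> x \<in> U \<and> continuous_map (subtopology X U) Y f"
  shows "continuous_map X Y f"
  unfolding continuous_map_def
proof (intro conjI allI impI)
  show "f \<in> topspace X \<rightarrow> topspace Y"
  proof
    fix x assume "x \<in> topspace X"
    then obtain U where "openin X U" "x \<in> U" "continuous_map (subtopology X U) Y f"
      using assms by blast
    then show "f x \<in> topspace Y"
      using \<open>x \<in> topspace X\<close> by (auto simp: continuous_map_def Pi_iff)
  qed
  fix V assume V: "openin Y V"
  show "openin X {x \<in> topspace X. f x \<in> V}"
  proof (subst openin_subopen, intro ballI)
    fix x assume x: "x \<in> {x \<in> topspace X. f x \<in> V}"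
    then obtain U where U: "openin X U" "x \<in> U" "continuous_map (subtopology X U) Y f"
      using assms by blast
    then have "openin (subtopology X U) {x \<in> topspace (subtopology X U). f x \<in> V}"
      using V by (simp add: continuous_map_def)
    then have "openin X {x \<in> topspace (subtopology X U). f x \<in> V}"
      using U(1) openin_trans_full by blast
    then show "\<exists>T. openin X T \<and> x \<in> T \<and> T \<subseteq> {x \<in> topspace X. f x \<in> V}"
      using x by (intro exI[of _ "{x \<in> topspace (subtopology X U). f x \<in> V}"]) (auto simp: U(2))
  qed
qed

text \<open>The Leibniz formula is a polynomial in the entries.\<close>

lemma continuous_map_arr_det:
  assumes "\<And>i j. i < K \<Longrightarrow> j < K \<Longrightarrow> continuous_map X euclidean (\<lambda>x. A x i j)"
  shows "continuous_map X euclidean (\<lambda>x. arr_det K (A x))"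
proof -
  have "arr_det K (A x) = (\<Sum>p | p permutes {0..<K}. signof p * (\<Prod>i = 0..<K. A x i (p i)))" for x
    unfolding arr_det_def
    by (subst det_def'[of _ K]) (auto intro!: sum.cong prod.cong dest: permutes_in_image)
  moreover have "p i < K" if "p permutes {0..<K}" "i < K" for p i
    using permutes_in_image[OF that(1), of i] that by auto
  ultimately show ?thesis
    using assms by (auto intro!: cmap_intros)
qed

lemma continuous_map_arr_adj:
  assumes "\<And>i j. i < K \<Longrightarrow> j < K \<Longrightarrow> continuous_map X euclidean (\<lambda>x. A x i j)"
    and "i < K" "j < K"
  shows "continuous_map X euclidean (\<lambda>x. arr_adj K (A x) i j)"
proof -
  \<comment> \<open>\<open>s j\<close> enumerates in order the indices other than \<open>j\<close>,
    so an adjugate entry is a signed determinant of size \<open>K - 1\<close> of reindexed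
    entries.\<close>
  define s where "s j k = (if k < j then k else Suc k)" for j k :: nat
  have s: "s j k < K" if "k < K - 1" "j < K" for j k
    using that by (auto simp: s_def)
  have "arr_adj K (A x) i j = (-1)^(j+i) * arr_det (K - 1) (\<lambda>k l. A x (s j k) (s i l))" for x
  proof -
    have "mat_delete (Matrix.mat K K (\<lambda>(i,j). A x i j)) j i
        = Matrix.mat (K-1) (K-1) (\<lambda>(k,l). A x (s j k) (s i l))"
      unfolding mat_delete_def
      by (rule eq_matI) (use s assms(2,3) in \<open>auto simp: s_def\<close>)
    then show ?thesis
      using assms(2,3) by (simp add: arr_adj_def adj_mat_def cofactor_def arr_det_def)
  qed
  then show ?thesis
    using s assms by (auto intro!: cmap_intros continuous_map_arr_det)
qed

section \<open>Frames and orthogonal projections\<close>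

lemma cspan_memI: "(\<lambda>i. \<Sum>j<K. c j * vs j i) \<in> cspan K vs"
  unfolding cspan_def by blast

lemma cspan_gen: "j < K \<Longrightarrow> vs j \<in> cspan K vs"
  using cspan_memI[of "\<lambda>l. if l = j then 1 else 0" vs K]
  by (simp add: if_distrib[of "\<lambda>x. x * _"] cong: if_cong)

lemma cspan_zero: "(\<lambda>i. 0) \<in> cspan K vs"
  using cspan_memI[of "\<lambda>l. 0" vs K] by simp

lemma cspan_add:
  assumes "v \<in> cspan K vs" "w \<in> cspan K vs"
  shows "(\<lambda>i. v i + w i) \<in> cspan K vs"
proof -
  obtain c d where "v = (\<lambda>i. \<Sum>j<K. c j * vs j i)" "w = (\<lambda>i. \<Sum>j<K. d j * vs j i)"
    using assms unfolding cspan_def by blast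
  then show ?thesis
    using cspan_memI[of "\<lambda>j. c j + d j" vs K] by (simp add: sum.distrib algebra_simps)
qed

lemma cspan_scale:
  assumes "v \<in> cspan K vs"
  shows "(\<lambda>i. a * v i) \<in> cspan K vs"
proof -
  obtain c where "v = (\<lambda>i. \<Sum>j<K. c j * vs j i)"
    using assms unfolding cspan_def by blast
  then show ?thesis
    using cspan_memI[of "\<lambda>j. a * c j" vs K] by (simp add: sum_distrib_left algebra_simps)
qed

lemma cspan_diff:
  assumes "v \<in> cspan K vs" "w \<in> cspan K vs"
  shows "(\<lambda>i. v i - w i) \<in> cspan K vs"
  using cspan_add[OF assms(1) cspan_scale[OF assms(2), of "-1"]] by simp

lemma cspan_lincomb:
  fixes L :: nat
  assumes "\<And>j. j < L \<Longrightarrow> w j \<in> cspan K vs"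
  shows "(\<lambda>i. \<Sum>j<L. c j * w j i) \<in> cspan K vs"
  using assms
proof (induction L)
  case 0
  then show ?case by (simp add: cspan_zero)
next
  case (Suc L)
  then show ?case by (auto intro!: cspan_add cspan_scale)
qed

lemma cspan_subset:
  fixes L :: nat
  assumes "\<And>j. j < L \<Longrightarrow> w j \<in> cspan K vs"
  shows "cspan L w \<subseteq> cspan K vs"
proof
  fix v assume "v \<in> cspan L w"
  then obtain c where "v = (\<lambda>i. \<Sum>j<L. c j * w j i)"
    unfolding cspan_def by blast
  then show "v \<in> cspan K vs" using cspan_lincomb[OF assms] by simp
qed

text \<open>Associativity of the product of a row, a matrix and a column; it brings the adjugate
  next to its matrix in the computations below.\<close>

lemma sum_swap_mult:
  fixes f :: "nat \<Rightarrow> complex"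
  shows "(\<Sum>j<K. f j * (\<Sum>l<L. g j l * h l)) = (\<Sum>l<L. (\<Sum>j<K. f j * g j l) * h l)"
  by (subst sum_distrib_left, subst sum.swap)
     (simp add: sum_distrib_right mult.assoc)

text \<open>The dimension count is done by a matrix: independence of \<open>ws\<close> makes the
  matrix \<open>a\<close> expressing \<open>ws\<close> through \<open>vs\<close> invertible, and
  Cramer's rule then expresses \<open>vs\<close> through \<open>ws\<close>.\<close>

lemma cspan_eqI:
  assumes ind: "cindep K ws" and ws: "\<And>j. j < K \<Longrightarrow> ws j \<in> cspan K vs"
  shows "cspan K ws = cspan K vs"
proof
  show "cspan K ws \<subseteq> cspan K vs" by (rule cspan_subset[OF ws])
  have "\<forall>j. \<exists>a. j < K \<longrightarrow> ws j = (\<lambda>i. \<Sum>l<K. a l * vs l i)"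
    using ws unfolding cspan_def by blast
  then obtain a where a: "\<And>j i. j < K \<Longrightarrow> ws j i = (\<Sum>l<K. a j l * vs l i)"
    by metis
  have "arr_det K a \<noteq> 0"
  proof (rule arr_det_nonzero)
    fix c assume c: "\<And>l. l < K \<Longrightarrow> (\<Sum>j<K. c j * a j l) = 0"
    have "(\<Sum>j<K. c j * ws j i) = 0" for i
    proof -
      have "(\<Sum>j<K. c j * ws j i) = (\<Sum>j<K. c j * (\<Sum>l<K. a j l * vs l i))"
        using a by simp
      also have "\<dots> = (\<Sum>l<K. (\<Sum>j<K. c j * a j l) * vs l i)" by (rule sum_swap_mult)
      finally show ?thesis using c by simp
    qed
    then show "\<forall>j<K. c j = 0" using ind unfolding cindep_def by blast
  qed
  show "cspan K vs \<subseteq> cspan K ws"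
  proof (rule cspan_subset)
    fix l assume l: "l < K"
    have "vs l i = (\<Sum>j<K. (arr_adj K a l j / arr_det K a) * ws j i)" for i
    proof -
      have "(\<Sum>j<K. arr_adj K a l j * ws j i) = (\<Sum>j<K. arr_adj K a l j * (\<Sum>m<K. a j m * vs m i))"
        using a by simp
      also have "\<dots> = (\<Sum>m<K. (\<Sum>j<K. arr_adj K a l j * a j m) * vs m i)" by (rule sum_swap_mult)
      also have "\<dots> = (\<Sum>m<K. if l = m then arr_det K a * vs m i else 0)"
        by (rule sum.cong) (use l in \<open>auto simp: arr_adj_left\<close>)
      also have "\<dots> = arr_det K a * vs l i" using l by simp
      finally show ?thesis
        using \<open>arr_det K a \<noteq> 0\<close> by (simp add: sum_divide_distrib[symmetric] divide_simps mult.commute)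
    qed
    then have "vs l = (\<lambda>i. \<Sum>j<K. (arr_adj K a l j / arr_det K a) * ws j i)" by blast
    then show "vs l \<in> cspan K ws" using cspan_memI by metis
  qed
qed

section \<open>Finite stages and the Hermitian product\<close>

lemma cvec_mono: "N \<le> M \<Longrightarrow> cvec N \<subseteq> cvec M"
  by (auto simp: cvec_def)

lemma stiefel_mono: "N \<le> M \<Longrightarrow> stiefel K N \<subseteq> stiefel K M"
  by (auto simp: stiefel_def)

lemma grass_mono: "N \<le> M \<Longrightarrow> grass K N \<subseteq> grass K M"
  unfolding grass_def using stiefel_mono by blast

lemma stiefel_cvec: "vs \<in> stiefel K N \<Longrightarrow> vs j \<in> cvec N"
  by (auto simp: stiefel_def cvec_def)

lemma cspan_cvec: "vs \<in> stiefel K N \<Longrightarrow> cspan K vs \<subseteq> cvec N"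
  by (auto simp: stiefel_def cvec_def cspan_def)

lemma grass_cvec: "S \<in> grass K N \<Longrightarrow> S \<subseteq> cvec N"
  unfolding grass_def using cspan_cvec by blast

lemma grass_inf_obtain:
  assumes "S \<in> grass_inf K"
  obtains vs N where "vs \<in> stiefel K N" "S = cspan K vs"
  using assms unfolding grass_inf_def grass_def by blast

lemma grass_subspace:
  assumes "S \<in> grass_inf K"
  shows grass_zero: "(\<lambda>i. 0) \<in> S"
    and grass_add: "v \<in> S \<Longrightarrow> w \<in> S \<Longrightarrow> (\<lambda>i. v i + w i) \<in> S"
    and grass_diff: "v \<in> S \<Longrightarrow> w \<in> S \<Longrightarrow> (\<lambda>i. v i - w i) \<in> S"
    and grass_scale: "v \<in> S \<Longrightarrow> (\<lambda>i. c * v i) \<in> S"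
  using assms by (auto elim!: grass_inf_obtain intro: cspan_zero cspan_add cspan_diff cspan_scale)

text \<open>The Hermitian product of \<open>\<complex>\<^sup>\<infinity>\<close>; restricting the sum to the support of the first
  argument makes it independent of the ambient \<open>\<complex>\<^sup>N\<close>.\<close>
definition hip :: "(nat \<Rightarrow> complex) \<Rightarrow> (nat \<Rightarrow> complex) \<Rightarrow> complex" where
  "hip v w = (\<Sum>i | v i \<noteq> 0. cnj (v i) * w i)"

lemma hip_cvec: "v \<in> cvec N \<Longrightarrow> hip v w = (\<Sum>i<N. cnj (v i) * w i)"
  unfolding hip_def by (rule sum.mono_neutral_left) (auto simp: cvec_def intro: leI)

lemma hip_add_right:
  "v \<in> cvec N \<Longrightarrow> hip v (\<lambda>i. w i + z i) = hip v w + hip v z"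
  by (simp add: hip_cvec sum.distrib algebra_simps)

lemma hip_diff_right:
  "v \<in> cvec N \<Longrightarrow> hip v (\<lambda>i. w i - z i) = hip v w - hip v z"
  by (simp add: hip_cvec sum_subtractf algebra_simps)

lemma hip_scale_right:
  "v \<in> cvec N \<Longrightarrow> hip v (\<lambda>i. c * w i) = c * hip v w"
  by (simp add: hip_cvec sum_distrib_left algebra_simps)

lemma hip_sum_right:
  fixes K :: nat
  assumes "v \<in> cvec N"
  shows "hip v (\<lambda>i. \<Sum>j<K. c j * w j i) = (\<Sum>j<K. c j * hip v (w j))"
proof -
  have "hip v (\<lambda>i. \<Sum>j<K. c j * w j i) = (\<Sum>i<N. \<Sum>j<K. c j * (cnj (v i) * w j i))"
    using assms by (simp add: hip_cvec sum_distrib_left algebra_simps)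
  also have "\<dots> = (\<Sum>j<K. c j * hip v (w j))"
    using assms by (subst sum.swap) (simp add: hip_cvec sum_distrib_left)
  finally show ?thesis .
qed

lemma hip_sum_left:
  fixes K :: nat
  assumes "\<And>j. vs j \<in> cvec N"
  shows "hip (\<lambda>i. \<Sum>j<K. c j * vs j i) w = (\<Sum>j<K. cnj (c j) * hip (vs j) w)"
proof -
  have "(\<lambda>i. \<Sum>j<K. c j * vs j i) \<in> cvec N" using assms by (auto simp: cvec_def)
  then have "hip (\<lambda>i. \<Sum>j<K. c j * vs j i) w = (\<Sum>i<N. \<Sum>j<K. cnj (c j) * (cnj (vs j i) * w i))"
    by (simp add: hip_cvec sum_distrib_right mult.assoc)
  also have "\<dots> = (\<Sum>j<K. cnj (c j) * hip (vs j) w)"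
    using assms by (subst sum.swap) (simp add: hip_cvec[where N=N] sum_distrib_left)
  finally show ?thesis .
qed

lemma hip_self_eq_0:
  assumes "v \<in> cvec N" "hip v v = 0"
  shows "v = (\<lambda>i. 0)"
proof
  fix i
  have "of_real (\<Sum>i<N. (cmod (v i))\<^sup>2) = (\<Sum>i<N. v i * cnj (v i))"
    by (simp only: of_real_sum complex_norm_square)
  also have "\<dots> = 0" using assms hip_cvec[of v N v] by (simp add: mult.commute)
  finally have "(\<Sum>i<N. (cmod (v i))\<^sup>2) = 0" by (simp only: of_real_eq_0_iff)
  then have "\<forall>i\<in>{..<N}. (cmod (v i))\<^sup>2 = 0" by (subst (asm) sum_nonneg_eq_0_iff) auto
  then show "v i = 0" using assms(1) by (cases "i < N") (auto simp: cvec_def)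
qed

section \<open>Coordinates in a frame and orthogonal projection\<close>

definition gram :: "(nat \<Rightarrow> nat \<Rightarrow> complex) \<Rightarrow> nat \<Rightarrow> nat \<Rightarrow> complex" where
  "gram vs l j = hip (vs l) (vs j)"

text \<open>Cramer's rule for the normal equations with the Gram matrix. The formula makes sense for
  every \<open>v\<close>: it gives the coordinates of the orthogonal projection of \<open>v\<close>,
  hence those of \<open>v\<close> itself if \<open>v\<close> lies in the span.\<close>

definition coef :: "nat \<Rightarrow> (nat \<Rightarrow> nat \<Rightarrow> complex) \<Rightarrow> (nat \<Rightarrow> complex) \<Rightarrow> nat \<Rightarrow> complex" where
  "coef K vs v j = (\<Sum>l<K. arr_adj K (gram vs) j l * hip (vs l) v) / arr_det K (gram vs)"

text \<open>\<open>hip\<close> is conjugate linear on the left, so a vanishing combination of rows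
  is a vector of the span, with conjugate coefficients, that is orthogonal to the frame. It is then
  orthogonal to itself.\<close>

lemma gram_det_nonzero:
  assumes vs: "vs \<in> stiefel K N"
  shows "arr_det K (gram vs) \<noteq> 0"
proof (rule arr_det_nonzero)
  fix c assume c: "\<And>i. i < K \<Longrightarrow> (\<Sum>j<K. c j * gram vs j i) = 0"
  define w where "w = (\<lambda>i. \<Sum>j<K. cnj (c j) * vs j i)"
  have wc: "w \<in> cvec N" unfolding w_def by (rule subsetD[OF cspan_cvec[OF vs] cspan_memI])
  have "hip w (vs l) = 0" if "l < K" for l
    using c[OF that] by (simp add: w_def hip_sum_left[OF stiefel_cvec[OF vs]] gram_def)
  then have "hip w w = 0"
    by (subst (2) w_def) (simp add: hip_sum_right[OF wc])
  then have "w = (\<lambda>i. 0)" using wc hip_self_eq_0 by blast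
  then have "\<forall>j<K. cnj (c j) = 0"
    using vs by (auto simp: w_def stiefel_def cindep_def)
  then show "\<forall>j<K. c j = 0" by simp
qed

lemma coef_lincomb:
  assumes vs: "vs \<in> stiefel K N" and "j < K"
  shows "coef K vs (\<lambda>i. \<Sum>l<K. c l * vs l i) j = c j"
proof -
  have "(\<Sum>l<K. arr_adj K (gram vs) j l * hip (vs l) (\<lambda>i. \<Sum>m<K. c m * vs m i))
      = (\<Sum>l<K. arr_adj K (gram vs) j l * (\<Sum>m<K. gram vs l m * c m))"
    by (simp add: hip_sum_right[OF stiefel_cvec[OF vs]] gram_def mult.commute)
  also have "\<dots> = (\<Sum>m<K. (\<Sum>l<K. arr_adj K (gram vs) j l * gram vs l m) * c m)"
    by (rule sum_swap_mult)
  also have "\<dots> = (\<Sum>m<K. if j = m then arr_det K (gram vs) * c m else 0)"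
    by (rule sum.cong) (use \<open>j < K\<close> in \<open>auto simp: arr_adj_left\<close>)
  also have "\<dots> = arr_det K (gram vs) * c j" using \<open>j < K\<close> by simp
  finally show ?thesis using gram_det_nonzero[OF vs] by (simp add: coef_def)
qed

lemma lincomb_coef:
  assumes vs: "vs \<in> stiefel K N" and v: "v \<in> cspan K vs"
  shows "(\<lambda>i. \<Sum>j<K. coef K vs v j * vs j i) = v"
proof -
  obtain c where c: "v = (\<lambda>i. \<Sum>j<K. c j * vs j i)"
    using v unfolding cspan_def by blast
  show ?thesis unfolding c by (simp add: coef_lincomb[OF vs])
qed

lemma coef_add:
  assumes vs: "vs \<in> stiefel K N"
  shows "coef K vs (\<lambda>i. v i + w i) j = coef K vs v j + coef K vs w j"
  by (simp add: coef_def hip_add_right[OF stiefel_cvec[OF vs]] sum.distrib algebra_simps add_divide_distrib)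

lemma coef_scale:
  assumes vs: "vs \<in> stiefel K N"
  shows "coef K vs (\<lambda>i. c * v i) j = c * coef K vs v j"
  by (simp add: coef_def hip_scale_right[OF stiefel_cvec[OF vs]] sum_distrib_left algebra_simps)

text \<open>Described through the subspace and not through a frame, so that it is a function on the
  Grassmannian whose continuity can be tested on frames.\<close>

definition proj :: "(nat \<Rightarrow> complex) set \<Rightarrow> (nat \<Rightarrow> complex) \<Rightarrow> (nat \<Rightarrow> complex)" where
  "proj S v = (THE u. u \<in> S \<and> (\<forall>w\<in>S. hip w (\<lambda>i. v i - u i) = 0))"

text \<open>The difference of two candidates lies in \<open>S\<close> and is orthogonal to
  \<open>S\<close>, in particular to itself.\<close>

lemma orth_unique:
  assumes S: "S \<in> grass_inf K"
    and u: "u \<in> S" "\<And>w. w \<in> S \<Longrightarrow> hip w (\<lambda>i. v i - u i) = 0"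
    and u': "u' \<in> S" "\<And>w. w \<in> S \<Longrightarrow> hip w (\<lambda>i. v i - u' i) = 0"
  shows "u = u'"
proof -
  obtain vs N where vs: "vs \<in> stiefel K N" "S = cspan K vs" using S by (rule grass_inf_obtain)
  define d where "d = (\<lambda>i. u' i - u i)"
  have dS: "d \<in> S" unfolding d_def using S u' u by (simp add: grass_diff)
  then have dc: "d \<in> cvec N" using cspan_cvec vs by blast
  have "hip d d = hip d (\<lambda>i. (v i - u i) - (v i - u' i))" by (simp add: d_def)
  also have "\<dots> = 0" using hip_diff_right[OF dc, of "\<lambda>i. v i - u i" "\<lambda>i. v i - u' i"] u u' dS by simp
  finally have "d = (\<lambda>i. 0)" using hip_self_eq_0[OF dc] by blast
  then have "u i = u' i" for i unfolding d_def by (metis eq_iff_diff_eq_0)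
  then show ?thesis by blast
qed

text \<open>The coordinates solve the normal equations: here the adjugate is cancelled from the
  right of the Gram matrix, whereas \<open>coef_lincomb\<close> cancels it from the left.\<close>

lemma frame_orth:
  assumes vs: "vs \<in> stiefel K N" and w: "w \<in> cspan K vs"
  shows "hip w (\<lambda>i. v i - (\<Sum>j<K. coef K vs v j * vs j i)) = 0"
proof -
  have orth: "hip (vs l) (\<lambda>i. v i - (\<Sum>j<K. coef K vs v j * vs j i)) = 0" if "l < K" for l
  proof -
    have "(\<Sum>j<K. gram vs l j * (\<Sum>m<K. arr_adj K (gram vs) j m * hip (vs m) v))
      = (\<Sum>m<K. (\<Sum>j<K. gram vs l j * arr_adj K (gram vs) j m) * hip (vs m) v)"
      by (rule sum_swap_mult)
    also have "\<dots> = (\<Sum>m<K. if l = m then arr_det K (gram vs) * hip (vs m) v else 0)"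
      by (rule sum.cong) (use \<open>l < K\<close> in \<open>auto simp: arr_adj_right\<close>)
    also have "\<dots> = arr_det K (gram vs) * hip (vs l) v" using \<open>l < K\<close> by simp
    finally have "(\<Sum>j<K. gram vs l j * coef K vs v j) = hip (vs l) v"
      using gram_det_nonzero[OF vs]
      by (simp add: coef_def sum_divide_distrib[symmetric] divide_simps mult.commute)
    then have "(\<Sum>j<K. coef K vs v j * hip (vs l) (vs j)) = hip (vs l) v"
      by (simp add: gram_def mult.commute)
    then show ?thesis
      by (simp add: hip_diff_right[OF stiefel_cvec[OF vs]] hip_sum_right[OF stiefel_cvec[OF vs]])
  qed
  obtain c where c: "w = (\<lambda>i. \<Sum>j<K. c j * vs j i)"
    using w unfolding cspan_def by blast
  show ?thesis
    unfolding c using orth by (simp add: hip_sum_left[OF stiefel_cvec[OF vs]])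
qed

lemma proj_eqI:
  assumes "S \<in> grass_inf K" "u \<in> S" "\<And>w. w \<in> S \<Longrightarrow> hip w (\<lambda>i. v i - u i) = 0"
  shows "proj S v = u"
  unfolding proj_def
proof (rule the_equality)
  show "u \<in> S \<and> (\<forall>w\<in>S. hip w (\<lambda>i. v i - u i) = 0)" using assms by blast
  fix u' assume "u' \<in> S \<and> (\<forall>w\<in>S. hip w (\<lambda>i. v i - u' i) = 0)"
  then show "u' = u" by (intro orth_unique[of S K u' v u]) (use assms in auto)
qed

lemma stiefel_grass_inf: "vs \<in> stiefel K N \<Longrightarrow> cspan K vs \<in> grass_inf K"
  unfolding grass_inf_def grass_def by blast

lemma proj_cspan:
  assumes "vs \<in> stiefel K N"
  shows "proj (cspan K vs) v = (\<lambda>i. \<Sum>j<K. coef K vs v j * vs j i)"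
  by (intro proj_eqI[OF stiefel_grass_inf[OF assms]] cspan_memI frame_orth[OF assms])

lemma
  assumes "S \<in> grass_inf K"
  shows proj_in: "proj S v \<in> S"
    and proj_orth: "w \<in> S \<Longrightarrow> hip w (\<lambda>i. v i - proj S v i) = 0"
    and proj_id: "v \<in> S \<Longrightarrow> proj S v = v"
    and proj_add: "proj S (\<lambda>i. v i + z i) = (\<lambda>i. proj S v i + proj S z i)"
    and proj_scale: "proj S (\<lambda>i. c * v i) = (\<lambda>i. c * proj S v i)"
  using assms
  by (auto elim!: grass_inf_obtain simp: proj_cspan frame_orth lincomb_coef coef_add coef_scale
      sum.distrib sum_distrib_left distrib_right mult.assoc intro: cspan_memI)

lemma proj_lincomb:
  fixes L :: nat
  assumes "S \<in> grass_inf K"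
  shows "proj S (\<lambda>i. \<Sum>j<L. c j * w j i) = (\<lambda>i. \<Sum>j<L. c j * proj S (w j) i)"
proof (induction L)
  case 0
  show ?case using proj_id[OF assms grass_zero[OF assms]] by simp
next
  case (Suc L)
  have "proj S (\<lambda>i. \<Sum>j<Suc L. c j * w j i)
      = proj S (\<lambda>i. (\<Sum>j<L. c j * w j i) + c L * w L i)" by simp
  then show ?case
    by (simp add: proj_add[OF assms, of "\<lambda>i. \<Sum>j<L. c j * w j i" "\<lambda>i. c L * w L i"]
        proj_scale[OF assms] Suc)
qed

definition unit_seq :: "nat \<Rightarrow> nat \<Rightarrow> complex" where
  "unit_seq k = (\<lambda>i. if i = k then 1 else 0)"

lemma cvec_expand: "v \<in> cvec N \<Longrightarrow> v = (\<lambda>i. \<Sum>k<N. v k * unit_seq k i)"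
  by (auto simp: unit_seq_def cvec_def fun_eq_iff if_distrib[of "\<lambda>x. _ * x"] cong: if_cong)

text \<open>Separates the two variables: a moving vector contributes only its coordinates, a moving
  subspace only the projections of finitely many fixed unit vectors.\<close>

lemma proj_expand:
  assumes "S \<in> grass_inf K" "v \<in> cvec N"
  shows "proj S v = (\<lambda>i. \<Sum>k<N. v k * proj S (unit_seq k) i)"
  by (subst cvec_expand[OF assms(2)]) (rule proj_lincomb[OF assms(1)])

section \<open>The anti-unitary map v |-> Q conj v\<close>

lemma Qconj_apply: "Qconj v i = (if even i then - cnj (v (Suc i)) else cnj (v (i - 1)))"
  by (simp add: Qconj_def Qmap_def)

lemma Qconj_Qconj: "Qconj (Qconj v) = (\<lambda>i. - v i)"
  by (auto simp: Qconj_apply fun_eq_iff)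

lemma Qconj_add: "Qconj (\<lambda>i. v i + w i) = (\<lambda>i. Qconj v i + Qconj w i)"
  by (auto simp: Qconj_apply fun_eq_iff)

lemma Qconj_diff: "Qconj (\<lambda>i. v i - w i) = (\<lambda>i. Qconj v i - Qconj w i)"
  by (auto simp: Qconj_apply fun_eq_iff)

lemma Qconj_scale: "Qconj (\<lambda>i. c * v i) = (\<lambda>i. cnj c * Qconj v i)"
  by (auto simp: Qconj_apply fun_eq_iff)

text \<open>The dimension is even because the coordinates 2j and 2j+1 are exchanged; an odd stage
  would lose the partner of its last coordinate.\<close>

lemma Qconj_cvec: "v \<in> cvec (2 * M) \<Longrightarrow> Qconj v \<in> cvec (2 * M)"
  unfolding cvec_def Qconj_apply by (auto elim!: oddE)

lemma sum_pairs:
  fixes f :: "nat \<Rightarrow> complex"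
  shows "(\<Sum>i<2*M. f i) = (\<Sum>j<M. f (2*j) + f (Suc (2*j)))"
  by (induction M) auto

text \<open>Within each pair of coordinates Q is a signed permutation, so comparing the sums pair by
  pair leaves only the conjugation.\<close>

lemma hip_Qconj:
  assumes "w \<in> cvec (2 * M)"
  shows "hip (Qconj w) (Qconj z) = cnj (hip w z)"
  unfolding hip_cvec[OF assms] hip_cvec[OF Qconj_cvec[OF assms]] sum_pairs
  by (simp add: Qconj_apply algebra_simps)

text \<open>An anti-unitary map preserves orthogonality, hence carries the decomposition of
  \<open>v\<close> along \<open>S\<close> to that of its image along \<open>rho S\<close>.\<close>

lemma proj_rho:
  assumes S: "S \<in> grass_inf K" and rS: "rho S \<in> grass_inf K"
  shows "proj (rho S) (Qconj v) = Qconj (proj S v)"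
proof (rule proj_eqI[OF rS])
  show "Qconj (proj S v) \<in> rho S" using proj_in[OF S] by (simp add: rho_def)
  obtain vs N where vs: "vs \<in> stiefel K N" "S = cspan K vs" using S by (rule grass_inf_obtain)
  have "S \<subseteq> cvec (2 * N)" using cspan_cvec[OF vs(1)] cvec_mono[of N "2 * N"] vs(2) by auto
  fix w assume "w \<in> rho S"
  then obtain w' where w': "w = Qconj w'" "w' \<in> S" by (auto simp: rho_def)
  have "hip w (Qconj (\<lambda>i. v i - proj S v i)) = cnj (hip w' (\<lambda>i. v i - proj S v i))"
    using w' \<open>S \<subseteq> _\<close> by (auto intro: hip_Qconj)
  then show "hip w (\<lambda>i. Qconj v i - Qconj (proj S v) i) = 0"
    using proj_orth[OF S w'(2)] by (simp add: Qconj_diff)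
qed

section \<open>The topology of the Grassmannian\<close>

lemma openin_final_top: "openin (final_top S T f) U \<longleftrightarrow> final_top_pred S T f U"
  by (simp add: final_top_def topology_inverse'[OF istopology_final_top_pred])

lemma topspace_final_top:
  assumes "\<And>N. f N ` topspace (T N) \<subseteq> S"
  shows "topspace (final_top S T f) = S"
proof
  show "topspace (final_top S T f) \<subseteq> S"
    by (auto simp: topspace_def openin_final_top final_top_pred_def)
  have "{x \<in> topspace (T N). f N x \<in> S} = topspace (T N)" for N using assms by blast
  then have "openin (final_top S T f) S"
    by (simp add: openin_final_top final_top_pred_def)
  then show "S \<subseteq> topspace (final_top S T f)" by (rule openin_subset)
qed

lemma continuous_map_into_final_top:
  assumes "\<And>N. f N ` topspace (T N) \<subseteq> S"
  shows "continuous_map (T N) (final_top S T f) (f N)"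
  using assms
  by (auto simp: continuous_map_def topspace_final_top openin_final_top final_top_pred_def)

lemma continuous_map_from_final_top:
  assumes S: "\<And>N. f N ` topspace (T N) \<subseteq> S" and "S \<subseteq> (\<Union>N. f N ` topspace (T N))"
    and g: "\<And>N. continuous_map (T N) Z (\<lambda>x. g (f N x))"
  shows "continuous_map (final_top S T f) Z g"
  unfolding continuous_map_def topspace_final_top[OF S]
proof (intro conjI allI impI)
  show "g \<in> S \<rightarrow> topspace Z" 
  proof
    fix y assume "y \<in> S"
    then obtain N x where "x \<in> topspace (T N)" "y = f N x" using assms(2) by blast
    then show "g y \<in> topspace Z" using g[of N] by (auto simp: continuous_map_def Pi_iff)
  qed
  fix U assume "openin Z U"
  then have "openin (T N) {x \<in> topspace (T N). g (f N x) \<in> U}" for N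
    using g by (simp add: continuous_map_def)
  moreover have "{x \<in> topspace (T N). f N x \<in> {x \<in> S. g x \<in> U}}
      = {x \<in> topspace (T N). g (f N x) \<in> U}" for N using S by blast
  ultimately show "openin (final_top S T f) {x \<in> S. g x \<in> U}"
    by (auto simp: openin_final_top final_top_pred_def)
qed

section \<open>Continuity and separation on the Grassmannian\<close>

lemma topspace_stiefel_top [simp]: "topspace (stiefel_top K N) = stiefel K N"
  by (simp add: stiefel_top_def)

lemma cspan_stages: "(\<lambda>N. cspan K) N ` topspace (stiefel_top K N) \<subseteq> grass_inf K"
  by (auto simp: stiefel_grass_inf)

lemma topspace_grass_top [simp]: "topspace (grass_top K) = grass_inf K"
  unfolding grass_top_def by (rule topspace_final_top[OF cspan_stages])

lemma continuous_map_cspan: "continuous_map (stiefel_top K N) (grass_top K) (cspan K)"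
  unfolding grass_top_def by (rule continuous_map_into_final_top[OF cspan_stages])

lemma continuous_map_from_grass_top:
  assumes "\<And>N. continuous_map (stiefel_top K N) Z (\<lambda>vs. g (cspan K vs))"
  shows "continuous_map (grass_top K) Z g"
  unfolding grass_top_def
  by (rule continuous_map_from_final_top[OF cspan_stages])
     (use assms in \<open>auto simp: grass_inf_def grass_def\<close>)

lemma continuous_map_into_stiefel_top:
  "continuous_map Y (stiefel_top K N) s \<longleftrightarrow>
     (\<forall>j i. continuous_map Y euclidean (\<lambda>y. s y j i)) \<and> (\<forall>y\<in>topspace Y. s y \<in> stiefel K N)"
  by (auto simp: stiefel_top_def continuous_map_in_subtopology continuous_map_into_seq_iff)

text \<open>The range of the sum in \<open>hip\<close> is the support of its first argument, which
  may jump with \<open>y\<close>. On a stage it is replaced by the fixed range below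
  \<open>N\<close>.\<close>

lemma continuous_map_hip:
  assumes s: "continuous_map Y (stiefel_top K N) s" and v: "continuous_map Y euclidean v"
  shows "continuous_map Y euclidean (\<lambda>y. hip (s y l) (v y))"
proof (rule continuous_map_eq)
  show "continuous_map Y euclidean (\<lambda>y. \<Sum>i<N. cnj (s y l i) * v y i)"
    using s v unfolding continuous_map_into_stiefel_top continuous_map_into_seq_iff
    by (intro cmap_intros) auto
  show "(\<Sum>i<N. cnj (s y l i) * v y i) = hip (s y l) (v y)" if "y \<in> topspace Y" for y
    using that s hip_cvec[OF stiefel_cvec] unfolding continuous_map_into_stiefel_top by metis
qed

lemma continuous_map_coef:
  assumes s: "continuous_map Y (stiefel_top K N) s" and v: "continuous_map Y euclidean v"
    and j: "j < K"
  shows "continuous_map Y euclidean (\<lambda>y. coef K (s y) (v y) j)"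
proof -
  have g: "continuous_map Y euclidean (\<lambda>y. gram (s y) l m)" for l m
    unfolding gram_def
    by (rule continuous_map_hip[OF s]) (use s in \<open>auto simp: continuous_map_into_stiefel_top continuous_map_into_seq_iff\<close>)
  show ?thesis
    unfolding coef_def
    by (intro cmap_intros continuous_map_arr_adj continuous_map_arr_det g continuous_map_hip[OF s] v)
       (use s j gram_det_nonzero in \<open>auto simp: continuous_map_into_stiefel_top\<close>)
qed

text \<open>By the final topology it suffices to compose with \<open>cspan K\<close> on each Stiefel
  space, where the projection is an explicit formula in the frame.\<close>

lemma continuous_map_proj: "continuous_map (grass_top K) euclidean (\<lambda>S. proj S v)"
proof (rule continuous_map_from_grass_top)
  fix N
  have id: "continuous_map (stiefel_top K N) (stiefel_top K N) (\<lambda>vs. vs)" by simp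
  have pr: "continuous_map (stiefel_top K N) euclidean (\<lambda>vs. vs j i)" for j i
    using id unfolding continuous_map_into_stiefel_top by blast
  show "continuous_map (stiefel_top K N) euclidean (\<lambda>vs. proj (cspan K vs) v)"
    unfolding continuous_map_into_seq_iff
  proof
    fix i
    have "continuous_map (stiefel_top K N) euclidean (\<lambda>vs. \<Sum>j<K. coef K vs v j * vs j i)"
      by (intro cmap_intros continuous_map_coef[OF id] pr) auto
    then show "continuous_map (stiefel_top K N) euclidean (\<lambda>vs. proj (cspan K vs) v i)"
      by (rule continuous_map_eq) (simp add: proj_cspan)
  qed
qed

text \<open>Projections separate points: a vector in exactly one of two subspaces is fixed by
  exactly one of the two projections. The consequence used later is that finite sets are
  closed.\<close>

lemma Hausdorff_grass_top: "Hausdorff_space (grass_top K)"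
  unfolding Hausdorff_space_def
proof (intro allI impI)
  fix S T assume "S \<in> topspace (grass_top K) \<and> T \<in> topspace (grass_top K) \<and> S \<noteq> T"
  then have ST: "S \<in> grass_inf K" "T \<in> grass_inf K" "S \<noteq> T" by auto
  then obtain v where "v \<in> S \<and> v \<notin> T \<or> v \<in> T \<and> v \<notin> S" by blast
  then have ne: "proj S v \<noteq> proj T v"
    using proj_id proj_in ST by metis
  from hausdorff[OF ne]
  obtain A B where AB: "open A" "open B" "proj S v \<in> A" "proj T v \<in> B" "A \<inter> B = {}"
    by (elim exE conjE)
  let ?p = "\<lambda>A. {R \<in> topspace (grass_top K). proj R v \<in> A}"
  have "openin (grass_top K) (?p A)" "openin (grass_top K) (?p B)"
    using AB openin_continuous_map_preimage[OF continuous_map_proj[of K v]] by auto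
  then show "\<exists>U V. openin (grass_top K) U \<and> openin (grass_top K) V \<and> S \<in> U \<and> T \<in> V \<and> disjnt U V"
    by (intro exI[of _ "?p A"] exI[of _ "?p B"]) (use AB ST in \<open>auto simp: disjnt_def\<close>)
qed

text \<open>A compact set not contained in any stage would contain points \<open>x N\<close> outside the \<open>N\<close>-th
  stage; the complements of the tails \<open>{x N | N \<ge> M}\<close> are open because every stage meets a tail
  in a finite set.\<close>
lemma compact_image_in_stage:
  assumes \<phi>: "continuous_map Y (grass_top K) \<phi>" and Y: "compact_space Y"
  obtains N where "\<phi> ` topspace Y \<subseteq> grass K (2 * N)"
proof -
  have "\<exists>N. \<phi> ` topspace Y \<subseteq> grass K N"
  proof (rule ccontr)
    assume "\<not> ?thesis"
    then have "\<forall>N. \<exists>x. x \<in> \<phi> ` topspace Y \<and> x \<notin> grass K N" by blast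
    then obtain x where x: "\<And>N. x N \<in> \<phi> ` topspace Y" "\<And>N. x N \<notin> grass K N" by metis
    have xg: "x N \<in> grass_inf K" for N
      using x(1)[of N] continuous_map_image_subset_topspace[OF \<phi>] by auto
    define W where "W M = grass_inf K - x ` {M..}" for M
    have W_open: "openin (grass_top K) (W M)" for M
      unfolding grass_top_def openin_final_top final_top_pred_def
    proof (intro conjI allI)
      show "W M \<subseteq> grass_inf K" by (auto simp: W_def)
      fix L
        have "closedin (grass_top K) (x ` {M..<L})"
        using t1_space_closedin_finite[of "grass_top K"] Hausdorff_imp_t1_space[OF Hausdorff_grass_top] xg
        by auto
      then have "openin (grass_top K) (topspace (grass_top K) - x ` {M..<L})" by blast
      from openin_continuous_map_preimage[OF continuous_map_cspan this]
      have "openin (stiefel_top K L) {vs \<in> topspace (stiefel_top K L).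
            cspan K vs \<in> topspace (grass_top K) - x ` {M..<L}}" .
      moreover have "cspan K vs \<in> W M \<longleftrightarrow> cspan K vs \<in> topspace (grass_top K) - x ` {M..<L}"
        if "vs \<in> stiefel K L" for vs
      proof -
        have "cspan K vs \<noteq> x N" if "L \<le> N" for N
        proof
          assume "cspan K vs = x N"
          then have "x N \<in> grass K L" using \<open>vs \<in> stiefel K L\<close> unfolding grass_def by (metis imageI)
          then show False using x(2) grass_mono[OF that] by blast
        qed
        then have "cspan K vs \<in> x ` {M..} \<longleftrightarrow> cspan K vs \<in> x ` {M..<L}"
          by (force simp: not_le[symmetric])
        then show ?thesis by (simp add: W_def)
      qed
      then have "{vs \<in> topspace (stiefel_top K L). cspan K vs \<in> W M} =
        {vs \<in> topspace (stiefel_top K L). cspan K vs \<in> topspace (grass_top K) - x ` {M..<L}}"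
        by auto
      ultimately show "openin (stiefel_top K L) {vs \<in> topspace (stiefel_top K L). cspan K vs \<in> W M}"
        by simp
    qed
    have cov: "\<phi> ` topspace Y \<subseteq> \<Union>(range W)"
    proof
      fix S assume "S \<in> \<phi> ` topspace Y"
      then have "S \<in> grass_inf K" using continuous_map_image_subset_topspace[OF \<phi>] by auto
      then obtain L where "S \<in> grass K L" unfolding grass_inf_def by blast
      then have "S \<noteq> x N" if "L \<le> N" for N using x(2) grass_mono[OF that] by blast
      then have "S \<in> W L" using \<open>S \<in> grass_inf K\<close> by (auto simp: W_def)
      then show "S \<in> \<Union>(range W)" by blast
    qed
    have "compactin (grass_top K) (\<phi> ` topspace Y)"
      using image_compactin[OF _ \<phi>, of "topspace Y"] Y by (simp add: compact_space_def)
    then obtain \<F> where F: "finite \<F>" "\<F> \<subseteq> range W" "\<phi> ` topspace Y \<subseteq> \<Union>\<F>"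
      using cov W_open unfolding compactin_def by (metis (no_types, lifting) imageE)
    then obtain I where I: "finite I" "\<F> = W ` I" by (meson finite_subset_image)
    \<comment> \<open>Inserting 0 covers an empty \<open>I\<close>. As every \<open>i\<close> in
      \<open>I\<close> is at most \<open>M\<close>, the point \<open>x M\<close> lies in the tail
      removed from each \<open>W i\<close>.\<close>
    define M where "M = Max (insert 0 I)"
    have "x M \<in> \<Union>\<F>" using x(1) F by blast
    then obtain i where "i \<in> I" "x M \<in> W i" using I by blast
    moreover have "i \<le> M" using \<open>i \<in> I\<close> I by (simp add: M_def)
    ultimately show False by (auto simp: W_def)
  qed
  then obtain N where "\<phi> ` topspace Y \<subseteq> grass K N" by blast
  then show ?thesis using that[of N] grass_mono[of N "2 * N"] by auto
qed

text \<open>A frame of \<open>\<phi> y0\<close> is projected to the neighbouring subspaces. It stays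
  independent as long as the matrix of its coordinates in the original frame is invertible, which is
  an open condition.\<close>

lemma local_frame:
  assumes \<phi>: "continuous_map Y (grass_top K) \<phi>" and N: "\<phi> ` topspace Y \<subseteq> grass K N"
    and y0: "y0 \<in> topspace Y"
  obtains U s where "openin Y U" "y0 \<in> U" "continuous_map (subtopology Y U) (stiefel_top K N) s"
    "\<And>y. y \<in> U \<Longrightarrow> \<phi> y = cspan K (s y)"
proof -
  have gi: "\<phi> y \<in> grass_inf K" if "y \<in> topspace Y" for y
    using that continuous_map_image_subset_topspace[OF \<phi>] by auto
  obtain vs where vs: "vs \<in> stiefel K N" "\<phi> y0 = cspan K vs"
    using N y0 unfolding grass_def by blast
  \<comment> \<open>Rows from \<open>K\<close> on are zero, as membership in
    \<open>stiefel K N\<close> demands.\<close>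
  define s where "s y j = (if j < K then proj (\<phi> y) (vs j) else (\<lambda>i. 0))" for y j
  define A where "A y j l = coef K vs (s y j) l" for y j l
  have s_in: "s y j \<in> \<phi> y" if "y \<in> topspace Y" for y j
    using proj_in[OF gi[OF that]] grass_zero[OF gi[OF that]] by (simp add: s_def)
  have s_cont: "continuous_map Y euclidean (\<lambda>y. s y j)" for j
    using continuous_map_compose[OF \<phi> continuous_map_proj] by (simp add: s_def o_def)
  have A_cont: "continuous_map Y euclidean (\<lambda>y. A y j l)" if "l < K" for j l
    unfolding A_def by (rule continuous_map_coef[of _ _ N]) (use that s_cont vs in auto)
  have det: "continuous_map Y euclidean (\<lambda>y. arr_det K (A y))"
    by (rule continuous_map_arr_det) (use A_cont in auto)
  define U where "U = {y \<in> topspace Y. arr_det K (A y) \<in> - {0}}"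
  have "openin Y U"
    unfolding U_def by (rule openin_continuous_map_preimage[OF det]) auto
  \<comment> \<open>Projection onto \<open>\<phi> y0\<close> fixes the frame, so the coordinate
    matrix at \<open>y0\<close> is the identity.\<close>
  have "vs j = (\<lambda>i. \<Sum>l<K. (if l = j then 1 else 0) * vs l i)" if "j < K" for j
    using that by (simp add: if_distrib[of "\<lambda>x. x * _"] cong: if_cong)
  then have A0: "A y0 j l = (if l = j then 1 else 0)" if "j < K" "l < K" for j l
    using coef_lincomb[OF vs(1) that(2), of "\<lambda>l. if l = j then 1 else 0"] that vs(2)
      proj_id[OF gi[OF y0], of "vs j"] cspan_gen[of j K vs] by (simp add: A_def s_def)
  have "arr_det K (A y0) \<noteq> 0"
  proof (rule arr_det_nonzero)
    fix c assume c: "\<And>i. i < K \<Longrightarrow> (\<Sum>j<K. c j * A y0 j i) = 0"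
    show "\<forall>j<K. c j = 0"
    proof (intro allI impI)
      fix l assume "l < K"
      then have "(\<Sum>j<K. c j * A y0 j l) = (\<Sum>j<K. if l = j then c j else 0)"
        by (intro sum.cong) (auto simp: A0)
      then show "c l = 0" using c[OF \<open>l < K\<close>] \<open>l < K\<close> by simp
    qed
  qed
  then have "y0 \<in> U" using y0 by (simp add: U_def)
  have sU: "s y \<in> stiefel K N" if "y \<in> U" for y
  proof -
    have y: "y \<in> topspace Y" "arr_det K (A y) \<noteq> 0" using that by (auto simp: U_def)
    have "\<phi> y \<subseteq> cvec N" using grass_cvec N y by blast
    then have "s y j i = 0" if "j \<ge> K \<or> i \<ge> N" for j i
      using s_in[OF y(1), of j] that by (cases "j < K") (auto simp: cvec_def s_def)
    moreover have "cindep K (s y)"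
      unfolding cindep_def
    proof (intro allI impI)
      fix c j assume c: "(\<lambda>i. \<Sum>j<K. c j * s y j i) = (\<lambda>i. 0)" and "j < K"
      \<comment> \<open>\<open>coef\<close> is linear on all vectors, so a relation among the
        projected vectors becomes a relation among the rows of \<open>A y\<close>.\<close>
      have *: "(\<Sum>m<K. c m * A y m l) = 0" if "l < K" for l
      proof -
        have "coef K vs (\<lambda>i. \<Sum>m<n. c m * s y m i) l = (\<Sum>m<n. c m * A y m l)" for n
        proof (induction n)
          case 0
          show ?case using coef_scale[OF vs(1), of 0 "\<lambda>i. 0"] by simp
        next
          case (Suc n)
          then show ?case
            using coef_add[OF vs(1), of "\<lambda>i. \<Sum>m<n. c m * s y m i" "\<lambda>i. c n * s y n i"]
            by (simp add: coef_scale[OF vs(1)] A_def)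
        qed
        from this[of K] show ?thesis
          using c coef_scale[OF vs(1), of 0 "\<lambda>i. 0"] by simp
      qed
      \<comment> \<open>Multiplication by the adjugate isolates \<open>c j\<close> times the
        determinant.\<close>
      have "0 = (\<Sum>l<K. (\<Sum>m<K. c m * A y m l) * arr_adj K (A y) l j)"
        using * by simp
      also have "\<dots> = (\<Sum>m<K. c m * (\<Sum>l<K. A y m l * arr_adj K (A y) l j))"
        by (rule sum_swap_mult[symmetric])
      also have "\<dots> = (\<Sum>m<K. if m = j then c m * arr_det K (A y) else 0)"
        by (rule sum.cong) (use \<open>j < K\<close> in \<open>auto simp: arr_adj_right\<close>)
      also have "\<dots> = c j * arr_det K (A y)" using \<open>j < K\<close> by simp
      finally show "c j = 0" using y(2) by simp
    qed
    ultimately show ?thesis by (auto simp: stiefel_def)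
  qed
  show ?thesis
  proof
    show "openin Y U" "y0 \<in> U" by fact+
    show "continuous_map (subtopology Y U) (stiefel_top K N) s"
      unfolding continuous_map_into_stiefel_top
    proof (intro conjI allI ballI)
      show "continuous_map (subtopology Y U) euclidean (\<lambda>y. s y j i)" for j i
        using s_cont[of j]
        by (intro continuous_map_from_subtopology) (simp add: continuous_map_into_seq_iff)
      show "s y \<in> stiefel K N" if "y \<in> topspace (subtopology Y U)" for y
        using that sU by simp
    qed
    fix y assume "y \<in> U"
    then have y: "y \<in> topspace Y" by (auto simp: U_def)
    then obtain ws where ws: "\<phi> y = cspan K ws" using N unfolding grass_def by blast
    have "cspan K (s y) = cspan K ws"
      by (rule cspan_eqI) (use sU[OF \<open>y \<in> U\<close>] s_in[OF y] ws in \<open>auto simp: stiefel_def\<close>)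
    then show "\<phi> y = cspan K (s y)" using ws by simp
  qed
qed

lemma continuous_map_grass_local:
  assumes "\<And>y. y \<in> topspace Y \<Longrightarrow> \<exists>U N s. openin Y U \<and> y \<in> U \<and>
    continuous_map (subtopology Y U) (stiefel_top K N) s \<and> (\<forall>z\<in>U. \<phi> z = cspan K (s z))"
  shows "continuous_map Y (grass_top K) \<phi>"
proof (rule continuous_map_locally)
  fix y assume "y \<in> topspace Y"
  from assms[OF this]
  obtain U N s where U: "openin Y U" "y \<in> U"
    "continuous_map (subtopology Y U) (stiefel_top K N) s" "\<forall>z\<in>U. \<phi> z = cspan K (s z)"
    by (elim exE conjE)
  have "continuous_map (subtopology Y U) (grass_top K) \<phi>"
    by (rule continuous_map_eq[OF continuous_map_compose[OF U(3) continuous_map_cspan]])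
       (use U(4) in auto)
  then show "\<exists>U. openin Y U \<and> y \<in> U \<and> continuous_map (subtopology Y U) (grass_top K) \<phi>"
    using U by blast
qed

section \<open>Pull-backs of the tautological bundle\<close>

lemma cvec_stages: "(\<lambda>N v. v) N ` topspace (cvec_top N) \<subseteq> cinf"
  by (auto simp: cvec_top_def cinf_def)

lemma topspace_cinf_top [simp]: "topspace cinf_top = cinf"
  unfolding cinf_top_def by (rule topspace_final_top) (use cvec_stages in simp)

lemma topspace_cvec_top [simp]: "topspace (cvec_top N) = cvec N"
  by (simp add: cvec_top_def)

text \<open>The direct limit topology is at least as fine as the product topology on
  \<open>cinf\<close>, but on each stage the two agree: a product-open set meets every stage in an
  open set.\<close>

lemma subtopology_cinf_top: "subtopology cinf_top (cvec N) = subtopology euclidean (cvec N)"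
proof (unfold topology_eq, intro allI iffI)
  fix U assume "openin (subtopology cinf_top (cvec N)) U"
  then obtain W where W: "openin cinf_top W" "U = W \<inter> cvec N"
    unfolding openin_subtopology by blast
  then have "openin (cvec_top N) {x \<in> topspace (cvec_top N). x \<in> W}"
    unfolding cinf_top_def openin_final_top final_top_pred_def by blast
  moreover have "{x \<in> topspace (cvec_top N). x \<in> W} = U" using W by auto
  ultimately show "openin (top_of_set (cvec N)) U" by (simp add: cvec_top_def)
next
  fix U assume "openin (top_of_set (cvec N)) U"
  then obtain W where W: "open W" "U = W \<inter> cvec N"
    unfolding openin_subtopology by auto
  have "{x \<in> cvec M. x \<in> W \<inter> cinf} = cvec M \<inter> W" for M by (auto simp: cinf_def)
  then have "openin cinf_top (W \<inter> cinf)"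
    unfolding cinf_top_def openin_final_top final_top_pred_def
    using W(1) by (simp add: cvec_top_def openin_open_Int)
  moreover have "U = (W \<inter> cinf) \<inter> cvec N" using W by (auto simp: cinf_def)
  ultimately show "openin (subtopology cinf_top (cvec N)) U"
    unfolding openin_subtopology by blast
qed

text \<open>With all fibres in one stage, the direct limit factor of the total space may be
  exchanged for the product topology, which makes coordinatewise continuity proofs possible.\<close>

lemma pb_top_eq:
  assumes "\<forall>x\<in>topspace X. \<phi> x \<subseteq> cvec N"
  shows "pb_top X \<phi> = subtopology (prod_topology X euclidean) {(x, v). x \<in> topspace X \<and> v \<in> \<phi> x}"
proof -
  let ?P = "{(x, v). x \<in> topspace X \<and> v \<in> \<phi> x}"
  have P: "(topspace X \<times> cvec N) \<inter> ?P = ?P" using assms by auto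
  have "pb_top X \<phi> = subtopology (subtopology (prod_topology X cinf_top) (topspace X \<times> cvec N)) ?P"
    unfolding pb_top_def subtopology_subtopology P ..
  also have "subtopology (prod_topology X cinf_top) (topspace X \<times> cvec N)
      = subtopology (prod_topology X euclidean) (topspace X \<times> cvec N)"
    by (simp add: subtopology_Times subtopology_cinf_top)
  finally show ?thesis unfolding subtopology_subtopology P .
qed

lemma
  assumes "\<forall>x\<in>topspace X. \<phi> x \<subseteq> cvec N"
  shows topspace_pb_top: "topspace (pb_top X \<phi>) = {(x, v). x \<in> topspace X \<and> v \<in> \<phi> x}"
    and continuous_map_into_pb_top: "continuous_map Y (pb_top X \<phi>) f \<longleftrightarrow>
      continuous_map Y X (\<lambda>y. fst (f y)) \<and> continuous_map Y euclidean (\<lambda>y. snd (f y)) \<and>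
      (\<forall>y\<in>topspace Y. snd (f y) \<in> \<phi> (fst (f y)))"
    and continuous_map_fst_pb_top: "continuous_map (pb_top X \<phi>) X fst"
    and continuous_map_snd_pb_top: "continuous_map (pb_top X \<phi>) euclidean snd"
proof -
  note eq = pb_top_eq[of X \<phi>, OF assms]
  show "topspace (pb_top X \<phi>) = {(x, v). x \<in> topspace X \<and> v \<in> \<phi> x}"
    unfolding eq by auto
  show "continuous_map Y (pb_top X \<phi>) f \<longleftrightarrow>
      continuous_map Y X (\<lambda>y. fst (f y)) \<and> continuous_map Y euclidean (\<lambda>y. snd (f y)) \<and>
      (\<forall>y\<in>topspace Y. snd (f y) \<in> \<phi> (fst (f y)))"
    unfolding eq continuous_map_in_subtopology continuous_map_pairwise o_def
    by (auto simp: continuous_map_def Pi_iff split_beta)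
  show "continuous_map (pb_top X \<phi>) X fst" "continuous_map (pb_top X \<phi>) euclidean snd"
    unfolding eq by (auto intro: continuous_map_from_subtopology continuous_map_fst continuous_map_snd)
qed

text \<open>\<open>coef\<close> is unspecified from index \<open>K\<close> on, being read off
  outside a matrix, whereas vectors of \<open>cvec K\<close> vanish there.\<close>

definition trunc :: "nat \<Rightarrow> (nat \<Rightarrow> complex) \<Rightarrow> nat \<Rightarrow> complex" where
  "trunc K c = (\<lambda>j. if j < K then c j else 0)"

lemma trunc_cvec: "trunc K c \<in> cvec K"
  by (auto simp: trunc_def cvec_def)

lemma trunc_id: "c \<in> cvec K \<Longrightarrow> trunc K c = c"
  by (auto simp: trunc_def cvec_def fun_eq_iff)

lemma sum_trunc: "(\<Sum>j<K. trunc K c j * w j) = (\<Sum>j<K. c j * w j)"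
  by (rule sum.cong) (auto simp: trunc_def)

lemma continuous_map_into_cvec_top:
  "continuous_map Y (cvec_top K) f \<longleftrightarrow>
    (\<forall>j. continuous_map Y euclidean (\<lambda>y. f y j)) \<and> (\<forall>y\<in>topspace Y. f y \<in> cvec K)"
  by (auto simp: cvec_top_def continuous_map_in_subtopology continuous_map_into_seq_iff)

lemma continuous_map_trunc_coef:
  assumes "continuous_map Y (stiefel_top K N) s" "continuous_map Y euclidean v"
  shows "continuous_map Y (cvec_top K) (\<lambda>y. trunc K (coef K (s y) (v y)))"
  unfolding continuous_map_into_cvec_top
proof (intro conjI allI ballI)
  fix j show "continuous_map Y euclidean (\<lambda>y. trunc K (coef K (s y) (v y)) j)"
    by (cases "j < K") (use continuous_map_coef[OF assms] in \<open>auto simp: trunc_def\<close>)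
qed (rule trunc_cvec)

text \<open>Over the domain of a local frame, coordinates in the frame give the trivialisation
  \<open>h\<close> and linear combinations of the frame give its inverse \<open>k\<close>.\<close>

lemma pb_cvb:
  assumes \<phi>: "continuous_map X (grass_top K) \<phi>" and N: "\<phi> ` topspace X \<subseteq> grass K N"
  shows "cvb X K (pb_top X \<phi>) fst pb_add pb_sc"
proof -
  have gi: "\<phi> x \<in> grass_inf K" if "x \<in> topspace X" for x
    using that continuous_map_image_subset_topspace[OF \<phi>] by auto
  have cv: "\<forall>x\<in>topspace X. \<phi> x \<subseteq> cvec N" using N grass_cvec by blast
  note top [simp] = topspace_pb_top[OF cv]
  have loc: "\<exists>U h. openin X U \<and> x \<in> U \<and>
        homeomorphic_map (subtopology (pb_top X \<phi>) {e \<in> topspace (pb_top X \<phi>). fst e \<in> U})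
                         (prod_topology (subtopology X U) (cvec_top K)) h \<and>
        (\<forall>e\<in>topspace (pb_top X \<phi>). fst e \<in> U \<longrightarrow> fst (h e) = fst e) \<and>
        (\<forall>e\<in>topspace (pb_top X \<phi>). \<forall>f\<in>topspace (pb_top X \<phi>). fst e \<in> U \<longrightarrow> fst f = fst e \<longrightarrow>
            snd (h (pb_add e f)) = (\<lambda>i. snd (h e) i + snd (h f) i)) \<and>
        (\<forall>c. \<forall>e\<in>topspace (pb_top X \<phi>). fst e \<in> U \<longrightarrow>
            snd (h (pb_sc c e)) = (\<lambda>i. c * snd (h e) i))"
    if x: "x \<in> topspace X" for x
  proof -
    obtain U s where U: "openin X U" "x \<in> U"
      and s: "continuous_map (subtopology X U) (stiefel_top K N) s"
      and sp: "\<And>y. y \<in> U \<Longrightarrow> \<phi> y = cspan K (s y)"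
      using local_frame[OF \<phi> N x] by metis
    have UX: "U \<subseteq> topspace X" using U(1) by (rule openin_subset)
    have sU: "s y \<in> stiefel K N" if "y \<in> U" for y
      using s that UX unfolding continuous_map_into_stiefel_top by auto
    define h where "h e = (fst e, trunc K (coef K (s (fst e)) (snd e)))"
      for e :: "'a \<times> (nat \<Rightarrow> complex)"
    define k where "k = (\<lambda>(y, c). (y, \<lambda>i. \<Sum>j<K. c j * s y j i))"
    let ?D = "subtopology (pb_top X \<phi>) {e \<in> topspace (pb_top X \<phi>). fst e \<in> U}"
    let ?T = "prod_topology (subtopology X U) (cvec_top K)"
    have fstD: "continuous_map ?D (subtopology X U) fst"
      unfolding continuous_map_in_subtopology
      using continuous_map_fst_pb_top[OF cv] by (auto intro: continuous_map_from_subtopology)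
    have sndD: "continuous_map ?D euclidean snd"
      using continuous_map_snd_pb_top[OF cv] by (auto intro: continuous_map_from_subtopology)
    have sD: "continuous_map ?D (stiefel_top K N) (\<lambda>e. s (fst e))"
      using continuous_map_compose[OF fstD s] by (simp add: o_def)
    have h: "continuous_map ?D ?T h"
      unfolding continuous_map_pairwise
      using fstD continuous_map_trunc_coef[OF sD sndD] by (simp add: h_def o_def)
    have fstT: "continuous_map ?T (subtopology X U) fst"
      by (rule continuous_map_fst)
    have sT: "continuous_map ?T (stiefel_top K N) (\<lambda>q. s (fst q))"
      using continuous_map_compose[OF fstT s] by (simp add: o_def)
    have cT: "continuous_map ?T (cvec_top K) snd" by (rule continuous_map_snd)
    have "continuous_map ?T (pb_top X \<phi>) k"
      unfolding continuous_map_into_pb_top[OF cv]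
    proof (intro conjI ballI)
      show "continuous_map ?T X (\<lambda>y. fst (k y))"
        using fstT by (simp add: k_def split_beta continuous_map_in_subtopology)
      show "continuous_map ?T euclidean (\<lambda>y. snd (k y))"
        unfolding continuous_map_into_seq_iff k_def split_beta
        using sT cT unfolding continuous_map_into_stiefel_top continuous_map_into_cvec_top
        by (auto intro!: cmap_intros)
      show "snd (k q) \<in> \<phi> (fst (k q))" if "q \<in> topspace ?T" for q
        using that sp by (auto simp: k_def cspan_memI)
    qed
    then have k: "continuous_map ?T ?D k"
      unfolding continuous_map_in_subtopology
      using UX sp by (auto simp: k_def cspan_memI)
    have kh: "k (h e) = e" if "e \<in> topspace ?D" for e
    proof -
      obtain y v where e: "e = (y, v)" "y \<in> U" "v \<in> cspan K (s y)"
        using \<open>e \<in> topspace ?D\<close> sp by (cases e) auto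
      show ?thesis using lincomb_coef[OF sU[OF e(2)] e(3)]
        by (simp add: e(1) h_def k_def sum_trunc)
    qed
    have hk: "h (k q) = q" if "q \<in> topspace ?T" for q
    proof -
      obtain y c where q: "q = (y, c)" "y \<in> U" "c \<in> cvec K" using \<open>q \<in> topspace ?T\<close> by (cases q) auto
      have "trunc K (coef K (s y) (\<lambda>i. \<Sum>j<K. c j * s y j i)) = trunc K c"
        using coef_lincomb[OF sU[OF q(2)]] by (auto simp: trunc_def)
      then show ?thesis using trunc_id[OF q(3)] by (simp add: q(1) h_def k_def)
    qed
    have "homeomorphic_maps ?D ?T h k"
      unfolding homeomorphic_maps_def using h k hk kh by blast
    then have "homeomorphic_map ?D ?T h" by (simp add: homeomorphic_maps_map)
    then show ?thesis
      using U
      by (intro exI[of _ U] exI[of _ h])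
         (auto simp: h_def pb_add_def pb_sc_def trunc_def coef_add[OF sU] coef_scale[OF sU])
  qed
  show ?thesis
    unfolding cvb_def
    using continuous_map_fst_pb_top[OF cv] loc
    by (auto simp: pb_add_def pb_sc_def grass_add[OF gi] grass_scale[OF gi])
qed

lemma continuous_map_Qconj:
  assumes "continuous_map Y euclidean f"
  shows "continuous_map Y euclidean (\<lambda>y. Qconj (f y))"
  unfolding continuous_map_into_seq_iff
proof
  fix i show "continuous_map Y euclidean (\<lambda>y. Qconj (f y) i)"
    using assms by (cases "even i")
      (auto simp: Qconj_apply continuous_map_into_seq_iff intro!: cmap_intros)
qed

lemma pb_qbundle:
  assumes \<tau>: "involution X \<tau>" and eq: "equivariant_grass X \<tau> K \<phi>"
    and N: "\<phi> ` topspace X \<subseteq> grass K N"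
  shows "qbundle X \<tau> K (pb_top X \<phi>) fst pb_add pb_sc (pb_Theta \<tau>)"
proof -
  have \<phi>: "continuous_map X (grass_top K) \<phi>" and rho: "\<And>x. x \<in> topspace X \<Longrightarrow> \<phi> (\<tau> x) = rho (\<phi> x)"
    using eq by (auto simp: equivariant_grass_def)
  have gi: "\<phi> x \<in> grass_inf K" if "x \<in> topspace X" for x
    using that continuous_map_image_subset_topspace[OF \<phi>] by auto
  have cv: "\<forall>x\<in>topspace X. \<phi> x \<subseteq> cvec N" using N grass_cvec by blast
  note top [simp] = topspace_pb_top[OF cv]
  note fstc = continuous_map_fst_pb_top[OF cv] and sndc = continuous_map_snd_pb_top[OF cv]
  have \<tau>c: "continuous_map X X \<tau>" and \<tau>\<tau>: "\<And>x. x \<in> topspace X \<Longrightarrow> \<tau> (\<tau> x) = x"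
    using \<tau> by (auto simp: involution_def)
  have \<tau>X: "\<tau> x \<in> topspace X" if "x \<in> topspace X" for x
    using that continuous_map_image_subset_topspace[OF \<tau>c] by auto
  let ?P = "pb_top X \<phi>"
  have \<tau>f: "continuous_map ?P X (\<lambda>e. \<tau> (fst e))"
    using continuous_map_compose[OF fstc \<tau>c] by (simp add: o_def)
  have \<Theta>: "continuous_map ?P ?P (pb_Theta \<tau>)"
    unfolding continuous_map_into_pb_top[OF cv]
    using \<tau>f continuous_map_Qconj[OF sndc] rho by (auto simp: pb_Theta_def rho_def)
  \<comment> \<open>Since \<open>pb_Theta\<close> squares to -1, its inverse is its negative;
    continuity of the sign change makes that inverse continuous.\<close>
  have "continuous_map ?P ?P (\<lambda>e. pb_sc (-1) e)"
    unfolding continuous_map_into_pb_top[OF cv]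
  proof (intro conjI ballI)
    show "continuous_map ?P X (\<lambda>e. fst (pb_sc (-1) e))" using fstc by (simp add: pb_sc_def)
    show "continuous_map ?P euclidean (\<lambda>e. snd (pb_sc (-1) e))"
      using sndc by (simp add: pb_sc_def continuous_map_into_seq_iff continuous_map_uminus_complex)
    show "snd (pb_sc (-1) e) \<in> \<phi> (fst (pb_sc (-1) e))" if "e \<in> topspace ?P" for e
      using that grass_scale[OF gi, of "fst e" _ "-1"] by (auto simp: pb_sc_def)
  qed
  then have \<Theta>': "continuous_map ?P ?P (\<lambda>e. pb_sc (-1) (pb_Theta \<tau> e))"
    using continuous_map_compose[OF \<Theta>] by (auto simp: o_def)
  have Qm: "Qconj (\<lambda>i. - v i) = (\<lambda>i. - Qconj v i)" for v
    using Qconj_scale[of "-1" v] by simp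
  have "homeomorphic_maps ?P ?P (pb_Theta \<tau>) (\<lambda>e. pb_sc (-1) (pb_Theta \<tau> e))"
    unfolding homeomorphic_maps_def using \<Theta> \<Theta>'
    by (auto simp: pb_Theta_def pb_sc_def Qconj_Qconj Qm \<tau>\<tau>)
  then have "homeomorphic_map ?P ?P (pb_Theta \<tau>)" by (simp add: homeomorphic_maps_map)
  then show ?thesis
    unfolding qbundle_def
    using \<tau> pb_cvb[OF \<phi> N] \<tau>\<tau>
    by (auto simp: pb_Theta_def pb_sc_def pb_add_def Qconj_add Qconj_scale Qconj_Qconj)
qed

section \<open>Fibrewise injective maps into a complex space\<close>

text \<open>A bundle embedded fibre by fibre in C^N is the pull-back along the map of its image
  planes. The situation occurs three times: for a classifying map, for projections between
  neighbouring bundles, and over the cylinder for a homotopy.\<close>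

locale fibrewise_embedding =
  fixes X :: "'a topology" and K N :: nat and E :: "'e topology" and p :: "'e \<Rightarrow> 'a"
    and add :: "'e \<Rightarrow> 'e \<Rightarrow> 'e" and sc :: "complex \<Rightarrow> 'e \<Rightarrow> 'e"
    and G :: "'e \<Rightarrow> nat \<Rightarrow> complex" and \<phi> :: "'a \<Rightarrow> (nat \<Rightarrow> complex) set"
  assumes cvb: "cvb X K E p add sc"
    and G_cont: "continuous_map E euclidean G"
    and G_cvec: "\<And>e. e \<in> topspace E \<Longrightarrow> G e \<in> cvec N"
    and G_add: "\<And>e f. e \<in> topspace E \<Longrightarrow> f \<in> topspace E \<Longrightarrow> p e = p f \<Longrightarrow>
      G (add e f) = (\<lambda>i. G e i + G f i)"
    and G_sc: "\<And>c e. e \<in> topspace E \<Longrightarrow> G (sc c e) = (\<lambda>i. c * G e i)"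
    and G_inj: "\<And>e f. e \<in> topspace E \<Longrightarrow> f \<in> topspace E \<Longrightarrow> p e = p f \<Longrightarrow> G e = G f \<Longrightarrow> e = f"
    and \<phi>_eq: "\<And>x. x \<in> topspace X \<Longrightarrow> \<phi> x = G ` {e \<in> topspace E. p e = x}"
begin

lemma p_cont: "continuous_map E X p"
  using cvb by (simp add: cvb_def)

text \<open>A local trivialisation transports the standard basis to the fibres, and \<open>G\<close>
  maps it to a frame of \<open>\<phi>\<close>. The inverse trivialisation \<open>k\<close> is kept
  because it later provides the inverse of the embedding.\<close>

lemma section_frame:
  assumes x0: "x0 \<in> topspace X"
  obtains U s k where "openin X U" "x0 \<in> U" "continuous_map (subtopology X U) (stiefel_top K N) s"
    "\<forall>x\<in>U. \<phi> x = cspan K (s x)"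
    "continuous_map (prod_topology (subtopology X U) (cvec_top K)) E k"
    "\<forall>x\<in>U. \<forall>c\<in>cvec K. p (k (x, c)) = x"
    "\<forall>x\<in>U. \<forall>c\<in>cvec K. G (k (x, c)) = (\<lambda>i. \<Sum>j<K. c j * s x j i)"
proof -
  have addE: "add e f \<in> topspace E \<and> p (add e f) = p e"
    if "e \<in> topspace E" "f \<in> topspace E" "p e = p f" for e f
    using cvb that by (simp add: cvb_def)
  have scE: "sc c e \<in> topspace E \<and> p (sc c e) = p e" if "e \<in> topspace E" for c e
    using cvb that by (simp add: cvb_def)
  have "\<exists>U h. openin X U \<and> x0 \<in> U \<and>
        homeomorphic_map (subtopology E {e \<in> topspace E. p e \<in> U})
                         (prod_topology (subtopology X U) (cvec_top K)) h \<and>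
        (\<forall>e\<in>topspace E. p e \<in> U \<longrightarrow> fst (h e) = p e) \<and>
        (\<forall>e\<in>topspace E. \<forall>f\<in>topspace E. p e \<in> U \<longrightarrow> p f = p e \<longrightarrow>
            snd (h (add e f)) = (\<lambda>i. snd (h e) i + snd (h f) i)) \<and>
        (\<forall>c. \<forall>e\<in>topspace E. p e \<in> U \<longrightarrow>
            snd (h (sc c e)) = (\<lambda>i. c * snd (h e) i))"
    using cvb x0 unfolding cvb_def by (elim conjE) (drule (1) bspec)
  then obtain U h where U: "openin X U" "x0 \<in> U"
    and hom: "homeomorphic_map (subtopology E {e \<in> topspace E. p e \<in> U})
                         (prod_topology (subtopology X U) (cvec_top K)) h"
    and triv: "\<forall>e\<in>topspace E. p e \<in> U \<longrightarrow> fst (h e) = p e"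
      "\<forall>e\<in>topspace E. \<forall>f\<in>topspace E. p e \<in> U \<longrightarrow> p f = p e \<longrightarrow>
            snd (h (add e f)) = (\<lambda>i. snd (h e) i + snd (h f) i)"
      "\<forall>c. \<forall>e\<in>topspace E. p e \<in> U \<longrightarrow> snd (h (sc c e)) = (\<lambda>i. c * snd (h e) i)"
    by (elim exE conjE)
  have h_fst: "\<And>e. e\<in>topspace E \<Longrightarrow> p e \<in> U \<Longrightarrow> fst (h e) = p e"
    and h_add: "\<And>e f. e\<in>topspace E \<Longrightarrow> f\<in>topspace E \<Longrightarrow> p e \<in> U \<Longrightarrow> p f = p e \<Longrightarrow>
            snd (h (add e f)) = (\<lambda>i. snd (h e) i + snd (h f) i)"
    and h_sc: "\<And>c e. e\<in>topspace E \<Longrightarrow> p e \<in> U \<Longrightarrow> snd (h (sc c e)) = (\<lambda>i. c * snd (h e) i)"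
    using triv by blast+
  have UX: "U \<subseteq> topspace X" using U(1) by (rule openin_subset)
  let ?D = "subtopology E {e \<in> topspace E. p e \<in> U}"
  let ?T = "prod_topology (subtopology X U) (cvec_top K)"
  obtain k where "homeomorphic_maps ?D ?T h k" using hom unfolding homeomorphic_map_maps by blast
  then have k: "continuous_map ?T ?D k" and kh: "\<And>e. e \<in> topspace ?D \<Longrightarrow> k (h e) = e"
    and hk': "\<And>q. q \<in> topspace ?T \<Longrightarrow> h (k q) = q"
    unfolding homeomorphic_maps_def by auto
  have hk: "h (k (x, c)) = (x, c)" if "x \<in> U" "c \<in> cvec K" for x c
    using hk'[of "(x, c)"] that UX by auto
  have kE: "continuous_map ?T E k" using k by (simp add: continuous_map_in_subtopology)
  have T: "topspace ?T = U \<times> cvec K" using UX by auto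
  have kin: "k (x, c) \<in> topspace E" "p (k (x, c)) \<in> U" if "x \<in> U" "c \<in> cvec K" for x c
    using continuous_map_image_subset_topspace[OF k] that UX by (auto simp: image_subset_iff)
  have kp: "p (k (x, c)) = x" if "x \<in> U" "c \<in> cvec K" for x c
    using h_fst[OF kin[OF that]] hk[OF that] by simp
  have k_add: "k (x, \<lambda>i. c i + d i) = add (k (x, c)) (k (x, d))"
    if "x \<in> U" "c \<in> cvec K" "d \<in> cvec K" for x c d
  proof -
    let ?e = "add (k (x, c)) (k (x, d))"
    have e: "?e \<in> topspace E" "p ?e = x"
      using addE[of "k (x, c)" "k (x, d)"] kin kp that by auto
    have "h ?e = (x, \<lambda>i. c i + d i)"
      using h_fst[of ?e] h_add[of "k (x, c)" "k (x, d)"] e that kin kp hk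
      by (intro prod_eqI) auto
    then show ?thesis using kh[of ?e] e that by auto
  qed
  have k_sc: "k (x, \<lambda>i. a * c i) = sc a (k (x, c))" if "x \<in> U" "c \<in> cvec K" for x a c
  proof -
    let ?e = "sc a (k (x, c))"
    have e: "?e \<in> topspace E" "p ?e = x" using scE[of "k (x, c)"] kin kp that by auto
    have "h ?e = (x, \<lambda>i. a * c i)"
      using h_fst[of ?e] h_sc[of "k (x, c)" a] e that kin kp hk by (intro prod_eqI) auto
    then show ?thesis using kh[of ?e] e that by auto
  qed
  define s where "s x j = (if j < K then G (k (x, unit_seq j)) else (\<lambda>i. 0))" for x j
  have uc: "unit_seq j \<in> cvec K" if "j < K" for j using that by (auto simp: unit_seq_def cvec_def)
  have Gk: "G (k (x, c)) = (\<lambda>i. \<Sum>j<K. c j * s x j i)" if x: "x \<in> U" and c: "c \<in> cvec K" for x c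
  proof -
    have cn: "(\<lambda>i. \<Sum>j<n. c j * unit_seq j i) \<in> cvec K" if "n \<le> K" for n
      using that by (auto simp: cvec_def unit_seq_def)
    \<comment> \<open>The bundle only offers binary sums and multiples, so the combination is built
      up by induction on its length.\<close>
    have "G (k (x, \<lambda>i. \<Sum>j<n. c j * unit_seq j i)) = (\<lambda>i. \<Sum>j<n. c j * s x j i)" if "n \<le> K" for n
      using that
    proof (induction n)
      case 0
      \<comment> \<open>The zero vector is its own multiple by 0, so \<open>G\<close> vanishes
        there.\<close>
      show ?case
        using k_sc[of x "\<lambda>i. 0" 0] G_sc[OF kin(1), of x "\<lambda>i. 0" 0] x by (simp add: cvec_def)
    next
      case (Suc n)
      then have n: "n < K" by simp
      have "(\<lambda>i. c n * unit_seq n i) \<in> cvec K" using n by (auto simp: cvec_def unit_seq_def)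
      moreover have "G (k (x, \<lambda>i. c n * unit_seq n i)) = (\<lambda>i. c n * s x n i)"
        using k_sc[OF x uc[OF n]] G_sc[OF kin(1)[OF x uc[OF n]]] n by (simp add: s_def)
      ultimately show ?case
        using k_add[OF x cn[of n], of "\<lambda>i. c n * unit_seq n i"] Suc n x
          G_add[OF kin(1)[OF x cn[of n]] kin(1)[OF x], of "\<lambda>i. c n * unit_seq n i"] kp cn[of n]
        by simp
    qed
    from this[of K] show ?thesis using cvec_expand[OF c] by simp
  qed
  have sU: "s x \<in> stiefel K N" if x: "x \<in> U" for x
  proof -
    have "s x j i = 0" if "j \<ge> K \<or> i \<ge> N" for j i
      using that G_cvec[OF kin(1)[OF x uc]] by (cases "j < K") (auto simp: s_def cvec_def)
    moreover have "cindep K (s x)"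
      unfolding cindep_def
    proof (intro allI impI)
      fix c j assume c: "(\<lambda>i. \<Sum>j<K. c j * s x j i) = (\<lambda>i. 0)" and "j < K"
      have z: "(\<lambda>i. 0) \<in> cvec K" by (simp add: cvec_def)
      \<comment> \<open>The coefficients are arbitrary from \<open>K\<close> on; truncation makes
        them an admissible argument of \<open>k\<close> without changing the combination.\<close>
      have "G (k (x, trunc K c)) = G (k (x, \<lambda>i. 0))"
        using c by (simp add: Gk[OF x trunc_cvec] Gk[OF x z] sum_trunc)
      then have "k (x, trunc K c) = k (x, \<lambda>i. 0)"
        using G_inj kin kp x trunc_cvec z by metis
      then have "h (k (x, trunc K c)) = h (k (x, \<lambda>i. 0))" by simp
      then have "trunc K c = (\<lambda>i. 0)" using hk x trunc_cvec z by auto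
      then show "c j = 0" using \<open>j < K\<close> by (auto simp: trunc_def fun_eq_iff split: if_splits)
    qed
    ultimately show ?thesis by (auto simp: stiefel_def)
  qed
  have s_cont: "continuous_map (subtopology X U) euclidean (\<lambda>x. s x j)" for j
  proof (cases "j < K")
    case True
    have "continuous_map (subtopology X U) ?T (\<lambda>x. (x, unit_seq j))"
      unfolding continuous_map_pairwise using uc[OF True] by (simp add: o_def)
    then have "continuous_map (subtopology X U) euclidean (G \<circ> (k \<circ> (\<lambda>x. (x, unit_seq j))))"
      by (intro continuous_map_compose[OF _ G_cont] continuous_map_compose[OF _ kE])
    then show ?thesis using True by (simp add: s_def o_def)
  qed (simp add: s_def)
  show ?thesis
  proof (rule that[OF U])
    show "continuous_map (subtopology X U) (stiefel_top K N) s"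
      unfolding continuous_map_into_stiefel_top
      using s_cont sU by (auto simp: continuous_map_into_seq_iff)
    show "continuous_map ?T E k" by (fact kE)
    show "\<forall>x\<in>U. \<forall>c\<in>cvec K. p (k (x, c)) = x" using kp by blast
    show "\<forall>x\<in>U. \<forall>c\<in>cvec K. G (k (x, c)) = (\<lambda>i. \<Sum>j<K. c j * s x j i)"
      using Gk by blast
    show "\<forall>x\<in>U. \<phi> x = cspan K (s x)"
    proof
      fix x assume x: "x \<in> U"
      have "\<phi> x = G ` {e \<in> topspace E. p e = x}" using \<phi>_eq UX x by blast
      also have "{e \<in> topspace E. p e = x} = (\<lambda>c. k (x, c)) ` cvec K"
      proof (intro equalityI subsetI)
        fix e assume e: "e \<in> {e \<in> topspace E. p e = x}"
        then have "h e \<in> topspace ?T"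
          using homeomorphic_imp_surjective_map[OF hom] x by auto
        then have "snd (h e) \<in> cvec K" by (simp add: mem_Times_iff)
        moreover have "k (x, snd (h e)) = e"
          using kh[of e] h_fst[of e] e x prod.collapse[of "h e"] by simp
        ultimately show "e \<in> (\<lambda>c. k (x, c)) ` cvec K" by (metis imageI)
      qed (use kin kp x in auto)
      also have "G ` \<dots> = cspan K (s x)"
      proof (intro equalityI subsetI)
        fix v assume "v \<in> G ` (\<lambda>c. k (x, c)) ` cvec K"
        then show "v \<in> cspan K (s x)" using Gk[OF x] by (auto simp: cspan_memI)
      next
        fix v assume "v \<in> cspan K (s x)"
        then obtain c where "v = (\<lambda>i. \<Sum>j<K. c j * s x j i)" unfolding cspan_def by blast
        then have "v = G (k (x, trunc K c))" using Gk[OF x trunc_cvec] by (simp add: sum_trunc)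
        then show "v \<in> G ` (\<lambda>c. k (x, c)) ` cvec K" using trunc_cvec by blast
      qed
      finally show "\<phi> x = cspan K (s x)" .
    qed
  qed
qed

lemma span_frame:
  assumes x0: "x0 \<in> topspace X"
  obtains U s where "openin X U" "x0 \<in> U" "continuous_map (subtopology X U) (stiefel_top K N) s"
    "\<forall>x\<in>U. \<phi> x = cspan K (s x)"
  by (rule section_frame[OF x0]) (rule that)

lemma \<phi>_stage: "\<phi> ` topspace X \<subseteq> grass K N"
proof
  fix S assume "S \<in> \<phi> ` topspace X"
  then obtain x where x: "x \<in> topspace X" "S = \<phi> x" by blast
  obtain U s where "openin X U" "x \<in> U" "continuous_map (subtopology X U) (stiefel_top K N) s"
    "\<forall>x\<in>U. \<phi> x = cspan K (s x)"
    by (rule span_frame[OF x(1)])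
  then show "S \<in> grass K N"
    using x unfolding grass_def continuous_map_into_stiefel_top by auto
qed

lemma \<phi>_cont: "continuous_map X (grass_top K) \<phi>"
proof (rule continuous_map_grass_local)
  fix x assume x: "x \<in> topspace X"
  obtain U s where "openin X U" "x \<in> U" "continuous_map (subtopology X U) (stiefel_top K N) s"
    "\<forall>x\<in>U. \<phi> x = cspan K (s x)"
    by (rule span_frame[OF x])
  then show "\<exists>U N s. openin X U \<and> x \<in> U \<and> continuous_map (subtopology X U) (stiefel_top K N) s
      \<and> (\<forall>z\<in>U. \<phi> z = cspan K (s z))"
    by (intro exI[of _ U] exI[of _ N] exI[of _ s]) simp
qed

lemma \<phi>_cvec: "\<forall>x\<in>topspace X. \<phi> x \<subseteq> cvec N"
  using \<phi>_eq G_cvec by auto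

text \<open>Bijectivity comes from fibrewise injectivity and the choice of \<open>\<phi>\<close>.
  Continuity of the inverse is local: take coordinates in the frame \<open>s\<close> and feed them
  to \<open>k\<close>.\<close>

lemma homeo: "homeomorphic_map E (pb_top X \<phi>) (\<lambda>e. (p e, G e))"
proof -
  let ?F = "\<lambda>e. (p e, G e)"
  have pE: "p e \<in> topspace X" if "e \<in> topspace E" for e
    using that continuous_map_image_subset_topspace[OF p_cont] by auto
  have F: "continuous_map E (pb_top X \<phi>) ?F"
    unfolding continuous_map_into_pb_top[OF \<phi>_cvec]
    using p_cont G_cont pE by (auto simp: \<phi>_eq)
  note top = topspace_pb_top[OF \<phi>_cvec]
  have inj: "inj_on ?F (topspace E)" using G_inj by (auto simp: inj_on_def)
  define F' where "F' = the_inv_into (topspace E) ?F"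
  have F'F: "F' (?F e) = e" if "e \<in> topspace E" for e
    unfolding F'_def using that inj by (rule the_inv_into_f_f[rotated])
  have "\<exists>e\<in>topspace E. q = ?F e" if "q \<in> topspace (pb_top X \<phi>)" for q
    using that \<phi>_eq by (auto simp: top)
  then have FF': "?F (F' q) = q" if "q \<in> topspace (pb_top X \<phi>)" for q
    using that F'F by metis
  have "continuous_map (pb_top X \<phi>) E F'"
  proof (rule continuous_map_locally)
    fix q assume q: "q \<in> topspace (pb_top X \<phi>)"
    then have x: "fst q \<in> topspace X" by (auto simp: top)
    obtain U s k where U: "openin X U" "fst q \<in> U"
      and s: "continuous_map (subtopology X U) (stiefel_top K N) s"
      and sp: "\<forall>x\<in>U. \<phi> x = cspan K (s x)"
      and k: "continuous_map (prod_topology (subtopology X U) (cvec_top K)) E k"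
      and kp: "\<forall>x\<in>U. \<forall>c\<in>cvec K. p (k (x, c)) = x"
      and Gk: "\<forall>x\<in>U. \<forall>c\<in>cvec K. G (k (x, c)) = (\<lambda>i. \<Sum>j<K. c j * s x j i)"
      by (rule section_frame[OF x])
    have UX: "U \<subseteq> topspace X" using U(1) by (rule openin_subset)
    define W where "W = {q \<in> topspace (pb_top X \<phi>). fst q \<in> U}"
    have W: "openin (pb_top X \<phi>) W" unfolding W_def
      by (rule openin_continuous_map_preimage[OF continuous_map_fst_pb_top[OF \<phi>_cvec] U(1)])
    let ?W = "subtopology (pb_top X \<phi>) W"
    have f1: "continuous_map ?W (subtopology X U) fst"
      unfolding continuous_map_in_subtopology
      using continuous_map_fst_pb_top[OF \<phi>_cvec]
      by (auto simp: W_def intro: continuous_map_from_subtopology)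
    have f2: "continuous_map ?W euclidean snd"
      using continuous_map_snd_pb_top[OF \<phi>_cvec] by (auto intro: continuous_map_from_subtopology)
    have f3: "continuous_map ?W (stiefel_top K N) (\<lambda>q. s (fst q))"
      using continuous_map_compose[OF f1 s] by (simp add: o_def)
    define c where "c q = trunc K (coef K (s (fst q)) (snd q))" for q
    have "continuous_map ?W (prod_topology (subtopology X U) (cvec_top K)) (\<lambda>q. (fst q, c q))"
      unfolding continuous_map_pairwise c_def
      using f1 continuous_map_trunc_coef[OF f3 f2] by (simp add: o_def)
    from continuous_map_compose[OF this k]
    have *: "continuous_map ?W E (\<lambda>q. k (fst q, c q))" by (simp add: o_def)
    have "continuous_map ?W E F'"
    proof (rule continuous_map_eq[OF *])
      fix q assume "q \<in> topspace ?W"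
      then have q: "fst q \<in> U" "snd q \<in> cspan K (s (fst q))"
        using sp by (auto simp: W_def top)
      have cc: "c q \<in> cvec K" by (simp add: c_def trunc_cvec)
      have sN: "s (fst q) \<in> stiefel K N"
        using s q UX unfolding continuous_map_into_stiefel_top by auto
      have "?F (k (fst q, c q)) = q"
        using kp Gk q(1) cc lincomb_coef[OF sN q(2)]
        by (simp add: c_def sum_trunc)
      moreover have "k (fst q, c q) \<in> topspace E"
        using continuous_map_image_subset_topspace[OF k] q(1) cc UX by auto
      ultimately show "k (fst q, c q) = F' q" using F'F by metis
    qed
    then show "\<exists>U. openin (pb_top X \<phi>) U \<and> q \<in> U \<and> continuous_map (subtopology (pb_top X \<phi>) U) E F'"
      using W q U(2) by (intro exI[of _ W]) (auto simp: W_def)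
  qed
  then have "homeomorphic_maps E (pb_top X \<phi>) ?F F'"
    unfolding homeomorphic_maps_def using F FF' F'F by auto
  then show ?thesis by (simp add: homeomorphic_maps_map)
qed

end

section \<open>Every bundle is a pull-back\<close>

(* The name add is taken by a record selector of HOL-Algebra, hence ad. *)
definition fibre_linear :: "'e topology \<Rightarrow> ('e \<Rightarrow> 'a) \<Rightarrow> ('e \<Rightarrow> 'e \<Rightarrow> 'e) \<Rightarrow> (complex \<Rightarrow> 'e \<Rightarrow> 'e) \<Rightarrow>
    nat \<Rightarrow> ('e \<Rightarrow> nat \<Rightarrow> complex) \<Rightarrow> bool" where
  "fibre_linear E p ad sc N g \<longleftrightarrow>
     continuous_map E euclidean g \<and> (\<forall>e\<in>topspace E. g e \<in> cvec N) \<and>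
     (\<forall>e\<in>topspace E. \<forall>f\<in>topspace E. p e = p f \<longrightarrow> g (ad e f) = (\<lambda>i. g e i + g f i)) \<and>
     (\<forall>c. \<forall>e\<in>topspace E. g (sc c e) = (\<lambda>i. c * g e i))"

definition fibre_inj :: "'e topology \<Rightarrow> ('e \<Rightarrow> 'a) \<Rightarrow> 'a set \<Rightarrow> ('e \<Rightarrow> nat \<Rightarrow> complex) \<Rightarrow> bool" where
  "fibre_inj E p W g \<longleftrightarrow>
     (\<forall>e\<in>topspace E. \<forall>f\<in>topspace E. p e \<in> W \<longrightarrow> p e = p f \<longrightarrow> g e = g f \<longrightarrow> e = f)"

text \<open>A separating function \<open>f\<close> is 0 at \<open>x\<close> and 1 outside
  \<open>U\<close>. Cutting at height 1/2 makes \<open>\<mu>\<close> vanish on an open set that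
  covers the rest of \<open>X\<close>, so that products with \<open>\<mu>\<close> extend
  continuously by zero.\<close>

lemma cutoff_function:
  assumes "compact_space X" "Hausdorff_space X" "openin X U" "x \<in> U"
  obtains \<mu> :: "'a \<Rightarrow> real" and V where "continuous_map X euclidean \<mu>" "\<mu> x \<noteq> 0"
    "openin X V" "topspace X \<subseteq> U \<union> V" "\<forall>y\<in>V. \<mu> y = 0"
proof -
  have "normal_space X"
    using assms compact_Hausdorff_or_regular_imp_normal_space by blast
  then have "completely_regular_space X"
    using assms normal_imp_completely_regular_space_A Hausdorff_imp_t1_space by blast
  moreover have "closedin X (topspace X - U)" "x \<in> topspace X - (topspace X - U)"
    using assms openin_subset by fastforce+
  ultimately obtain f :: "'a \<Rightarrow> real" where f: "continuous_map X (top_of_set {0..1}) f"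
    "f x = 0" "f ` (topspace X - U) \<subseteq> {1}"
    unfolding completely_regular_space_def by meson
  have fc: "continuous_map X euclidean f" using f(1) by (simp add: continuous_map_in_subtopology)
  define V where "V = {y \<in> topspace X. f y \<in> {1/2<..}}"
  show ?thesis
  proof
    show "continuous_map X euclidean (\<lambda>y. max 0 (1/2 - f y))"
      using fc by (auto simp: continuous_map_euclidean_iff intro!: tendsto_intros tendsto_max)
    show "openin X V" unfolding V_def by (rule openin_continuous_map_preimage[OF fc]) auto
    show "topspace X \<subseteq> U \<union> V" using f(3) by (force simp: V_def)
  qed (use f(2) in \<open>auto simp: V_def\<close>)
qed

text \<open>The trivialising coordinates are multiplied by the cut-off and extended by zero;
  continuity is checked on the preimages of \<open>U\<close> and \<open>V\<close>, which cover
  \<open>E\<close>.\<close>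

lemma local_fibre_linear:
  assumes "compact_space X" "Hausdorff_space X" and cvb: "cvb X K E p ad sc"
    and x0: "x0 \<in> topspace X"
  obtains W g where "openin X W" "x0 \<in> W" "fibre_linear E p ad sc K g" "fibre_inj E p W g"
proof -
  have pc: "continuous_map E X p" using cvb by (simp add: cvb_def)
  have addE: "ad e f \<in> topspace E \<and> p (ad e f) = p e"
    if "e \<in> topspace E" "f \<in> topspace E" "p e = p f" for e f
    using cvb that by (simp add: cvb_def)
  have scE: "sc c e \<in> topspace E \<and> p (sc c e) = p e" if "e \<in> topspace E" for c e
    using cvb that by (simp add: cvb_def)
  have "\<exists>U h. openin X U \<and> x0 \<in> U \<and>
        homeomorphic_map (subtopology E {e \<in> topspace E. p e \<in> U})
                         (prod_topology (subtopology X U) (cvec_top K)) h \<and>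
        (\<forall>e\<in>topspace E. p e \<in> U \<longrightarrow> fst (h e) = p e) \<and>
        (\<forall>e\<in>topspace E. \<forall>f\<in>topspace E. p e \<in> U \<longrightarrow> p f = p e \<longrightarrow>
            snd (h (ad e f)) = (\<lambda>i. snd (h e) i + snd (h f) i)) \<and>
        (\<forall>c. \<forall>e\<in>topspace E. p e \<in> U \<longrightarrow>
            snd (h (sc c e)) = (\<lambda>i. c * snd (h e) i))"
    using cvb x0 unfolding cvb_def by (elim conjE) (drule (1) bspec)
  then obtain U h where U: "openin X U" "x0 \<in> U"
    and hom: "homeomorphic_map (subtopology E {e \<in> topspace E. p e \<in> U})
                         (prod_topology (subtopology X U) (cvec_top K)) h"
    and h_fst: "\<forall>e\<in>topspace E. p e \<in> U \<longrightarrow> fst (h e) = p e"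
    and h_add: "\<forall>e\<in>topspace E. \<forall>f\<in>topspace E. p e \<in> U \<longrightarrow> p f = p e \<longrightarrow>
            snd (h (ad e f)) = (\<lambda>i. snd (h e) i + snd (h f) i)"
    and h_sc: "\<forall>c. \<forall>e\<in>topspace E. p e \<in> U \<longrightarrow> snd (h (sc c e)) = (\<lambda>i. c * snd (h e) i)"
    by (elim exE conjE)
  obtain \<mu> :: "'a \<Rightarrow> real" and V where \<mu>: "continuous_map X euclidean \<mu>" "\<mu> x0 \<noteq> 0"
    and V: "openin X V" "topspace X \<subseteq> U \<union> V" "\<forall>y\<in>V. \<mu> y = 0"
    by (rule cutoff_function[OF assms(1,2) U])
  define D where "D = {e \<in> topspace E. p e \<in> U}"
  have D: "openin E D" unfolding D_def by (rule openin_continuous_map_preimage[OF pc U(1)])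
  define g where "g e = (if p e \<in> U then (\<lambda>i. of_real (\<mu> (p e)) * snd (h e) i) else (\<lambda>i. 0))" for e
  have \<mu>p: "continuous_map E euclidean (\<lambda>e. \<mu> (p e))"
    using continuous_map_compose[OF pc \<mu>(1)] by (simp add: o_def)
  have hT: "continuous_map (subtopology E D) (cvec_top K) (\<lambda>e. snd (h e))"
    using homeomorphic_imp_continuous_map[OF hom] continuous_map_compose[OF _ continuous_map_snd]
    by (auto simp: D_def o_def)
  have gc: "continuous_map E euclidean g"
  proof (rule continuous_map_locally)
    fix e assume e: "e \<in> topspace E"
    then have "p e \<in> topspace X" using continuous_map_image_subset_topspace[OF pc] by auto
    then consider "p e \<in> U" | "p e \<in> V" using V(2) by blast
    then show "\<exists>A. openin E A \<and> e \<in> A \<and> continuous_map (subtopology E A) euclidean g"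
    proof cases
      case 1
      have "continuous_map (subtopology E D) euclidean (\<lambda>e i. of_real (\<mu> (p e)) * snd (h e) i)"
        unfolding continuous_map_into_seq_iff
        using hT continuous_map_from_subtopology[OF \<mu>p]
        by (auto simp: continuous_map_into_cvec_top intro!: cmap_intros)
      then have "continuous_map (subtopology E D) euclidean g"
        by (rule continuous_map_eq) (auto simp: D_def g_def)
      then show ?thesis using D 1 e by (intro exI[of _ D]) (auto simp: D_def)
    next
      case 2
      let ?B = "{e \<in> topspace E. p e \<in> V}"
      have "openin E ?B" by (rule openin_continuous_map_preimage[OF pc V(1)])
      moreover have "continuous_map (subtopology E ?B) euclidean g"
      proof (rule continuous_map_eq)
        show "continuous_map (subtopology E ?B) euclidean (\<lambda>e i. 0 :: complex)" by simp
      qed (use V(3) in \<open>auto simp: g_def\<close>)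
      ultimately show ?thesis using 2 e by (intro exI[of _ ?B]) auto
    qed
  qed
  show ?thesis
  proof
    \<comment> \<open>Where \<open>\<mu>\<close> is nonzero the factor cancels and the
      trivialisation can be recovered.\<close>
    let ?W = "U \<inter> {x \<in> topspace X. \<mu> x \<in> - {0}}"
    show "openin X ?W"
      by (intro openin_Int U openin_continuous_map_preimage[OF \<mu>(1)]) auto
    show "x0 \<in> ?W" using U x0 \<mu> by auto
    have "snd (h e) \<in> cvec K" if "e \<in> topspace E" "p e \<in> U" for e
      using that hT by (auto simp: continuous_map_into_cvec_top D_def)
    then have cv: "g e \<in> cvec K" if "e \<in> topspace E" for e
      using that by (auto simp: g_def cvec_def)
    have ga: "g (ad e f) = (\<lambda>i. g e i + g f i)"
      if "e \<in> topspace E" "f \<in> topspace E" "p e = p f" for e f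
      using addE[OF that] h_add that by (auto simp: g_def algebra_simps)
    have gs: "g (sc c e) = (\<lambda>i. c * g e i)" if "e \<in> topspace E" for c e
      using scE[OF that] h_sc that by (auto simp: g_def algebra_simps)
    show "fibre_linear E p ad sc K g"
      unfolding fibre_linear_def using gc cv ga gs by blast
    have "e = f" if ef: "e \<in> topspace E" "f \<in> topspace E" "p e \<in> ?W" "p e = p f" "g e = g f" for e f
    proof -
      have "snd (h e) i = snd (h f) i" for i
        using fun_cong[OF ef(5), of i] ef(1-4) by (auto simp: g_def)
      then have "h e = h f" using h_fst ef by (intro prod_eqI) auto
      then show ?thesis
        using homeomorphic_imp_injective_map[OF hom] ef by (auto simp: inj_on_def)
    qed
    then show "fibre_inj E p ?W g" unfolding fibre_inj_def by blast
  qed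
qed

definition stack :: "nat \<Rightarrow> (nat \<Rightarrow> complex) \<Rightarrow> (nat \<Rightarrow> complex) \<Rightarrow> nat \<Rightarrow> complex" where
  "stack M v w i = (if i < M then v i else w (i - M))"

lemma stack_eq:
  assumes "v \<in> cvec M" "v' \<in> cvec M"
  shows "stack M v w = stack M v' w' \<longleftrightarrow> v = v' \<and> w = w'"
proof
  assume st: "stack M v w = stack M v' w'"
  have "v i = v' i" for i
    using fun_cong[OF st, of i] assms by (cases "i < M") (auto simp: stack_def cvec_def)
  moreover have "w i = w' i" for i using fun_cong[OF st, of "i + M"] by (auto simp: stack_def)
  ultimately show "v = v' \<and> w = w'" by blast
qed simp

lemma fibre_linear_stack:
  assumes g: "fibre_linear E p ad sc M g" and h: "fibre_linear E p ad sc N h"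
  shows "fibre_linear E p ad sc (M + N) (\<lambda>e. stack M (g e) (h e))"
proof -
  have "continuous_map E euclidean (\<lambda>e. stack M (g e) (h e))"
    unfolding continuous_map_into_seq_iff
  proof
    fix i show "continuous_map E euclidean (\<lambda>e. stack M (g e) (h e) i)"
      using g h by (cases "i < M") (auto simp: stack_def fibre_linear_def continuous_map_into_seq_iff)
  qed
  moreover have "stack M (g e) (h e) \<in> cvec (M + N)" if "e \<in> topspace E" for e
    using g h that by (auto simp: stack_def fibre_linear_def cvec_def)
  ultimately show ?thesis
    using g h unfolding fibre_linear_def by (auto simp: stack_def)
qed

text \<open>Equal stacks agree in every block, so over each point a single injective block
  decides.\<close>

lemma finite_fibre_inj:
  assumes "finite \<F>"
    and "\<forall>W\<in>\<F>. \<exists>g. fibre_linear E p ad sc K g \<and> fibre_inj E p W g"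
  shows "\<exists>N g. fibre_linear E p ad sc N g \<and> fibre_inj E p (\<Union>\<F>) g"
  using assms
proof (induction \<F>)
  case empty
  have "fibre_linear E p ad sc 0 (\<lambda>e i. 0)" "fibre_inj E p {} (\<lambda>e i. 0)"
    by (auto simp: fibre_linear_def fibre_inj_def cvec_def)
  then show ?case by auto
next
  case (insert W \<F>)
  then obtain N g where g: "fibre_linear E p ad sc N g" "fibre_inj E p (\<Union>\<F>) g" by blast
  from insert obtain h where h: "fibre_linear E p ad sc K h" "fibre_inj E p W h" by blast
  have "fibre_inj E p (\<Union>(insert W \<F>)) (\<lambda>e. stack N (g e) (h e))"
    unfolding fibre_inj_def
  proof (intro ballI impI)
    fix e f assume ef: "e \<in> topspace E" "f \<in> topspace E" "p e \<in> \<Union>(insert W \<F>)" "p e = p f"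
      "stack N (g e) (h e) = stack N (g f) (h f)"
    have "g e \<in> cvec N" "g f \<in> cvec N" using g(1) ef by (auto simp: fibre_linear_def)
    then have "g e = g f" "h e = h f" using ef(5) by (auto simp: stack_eq)
    then show "e = f" using ef g(2) h(2) unfolding fibre_inj_def by auto
  qed
  then show ?case using fibre_linear_stack[OF g(1) h(1)] by blast
qed

lemma global_fibre_inj:
  assumes X: "compact_space X" "Hausdorff_space X" and cvb: "cvb X K E p ad sc"
  obtains N g where "fibre_linear E p ad sc N g" "fibre_inj E p (topspace X) g"
proof -
  define \<C> where "\<C> = {W. openin X W \<and> (\<exists>g. fibre_linear E p ad sc K g \<and> fibre_inj E p W g)}"
  have "x \<in> \<Union>\<C>" if x: "x \<in> topspace X" for x
  proof -
    obtain W g where "openin X W" "x \<in> W" "fibre_linear E p ad sc K g" "fibre_inj E p W g"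
      by (rule local_fibre_linear[OF X cvb x])
    then show ?thesis unfolding \<C>_def by blast
  qed
  then have "topspace X \<subseteq> \<Union>\<C>" by blast
  moreover have "\<forall>W\<in>\<C>. openin X W" by (simp add: \<C>_def)
  ultimately obtain \<F> where F: "finite \<F>" "\<F> \<subseteq> \<C>" "topspace X \<subseteq> \<Union>\<F>"
    using X(1) unfolding compact_space_alt by (metis (no_types, lifting))
  have "\<forall>W\<in>\<F>. \<exists>g. fibre_linear E p ad sc K g \<and> fibre_inj E p W g"
    using F(2) by (auto simp: \<C>_def)
  from finite_fibre_inj[OF F(1) this]
  obtain N g where g: "fibre_linear E p ad sc N g" "fibre_inj E p (\<Union>\<F>) g" by (elim exE conjE)
  then have "fibre_inj E p (topspace X) g" using F(3) unfolding fibre_inj_def by blast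
  then show ?thesis using g that by blast
qed

text \<open>The pair of \<open>g\<close> and \<open>- cnj \<circ> g \<circ> \<Theta>\<close>, interleaved, intertwines \<open>\<Theta>\<close> with \<open>v \<mapsto> Q (cnj v)\<close>.\<close>
definition quatern :: "('e \<Rightarrow> 'e) \<Rightarrow> ('e \<Rightarrow> nat \<Rightarrow> complex) \<Rightarrow> 'e \<Rightarrow> nat \<Rightarrow> complex" where
  "quatern \<Theta> g e i = (if even i then g e (i div 2) else - cnj (g (\<Theta> e) (i div 2)))"

lemma qbundle_is_pullback:
  assumes X: "compact_space X" "Hausdorff_space X" and qb: "qbundle X \<tau> K E p ad sc \<Theta>"
  shows "\<exists>\<phi>. equivariant_grass X \<tau> K \<phi> \<and> qiso E p ad sc \<Theta> (pb_top X \<phi>) fst pb_add pb_sc (pb_Theta \<tau>)"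
proof -
  have cvb: "cvb X K E p ad sc" and inv: "involution X \<tau>"
    and \<Theta>: "homeomorphic_map E E \<Theta>"
    and p\<Theta>: "\<And>e. e\<in>topspace E \<Longrightarrow> p (\<Theta> e) = \<tau> (p e)"
    and \<Theta>_add: "\<And>e f. e\<in>topspace E \<Longrightarrow> f\<in>topspace E \<Longrightarrow> p e = p f \<Longrightarrow> \<Theta> (ad e f) = ad (\<Theta> e) (\<Theta> f)"
    and \<Theta>_sc: "\<And>c e. e\<in>topspace E \<Longrightarrow> \<Theta> (sc c e) = sc (cnj c) (\<Theta> e)"
    and \<Theta>\<Theta>: "\<And>e. e\<in>topspace E \<Longrightarrow> \<Theta> (\<Theta> e) = sc (-1) e"
    using qb unfolding qbundle_def by auto
  obtain N g where g: "fibre_linear E p ad sc N g" and gi: "fibre_inj E p (topspace X) g"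
    by (rule global_fibre_inj[OF X cvb])
  have g_add: "\<And>e f. e\<in>topspace E \<Longrightarrow> f\<in>topspace E \<Longrightarrow> p e = p f \<Longrightarrow> g (ad e f) = (\<lambda>i. g e i + g f i)"
    and g_sc: "\<And>c e. e\<in>topspace E \<Longrightarrow> g (sc c e) = (\<lambda>i. c * g e i)"
    and g_cont: "continuous_map E euclidean g" and g_cv: "\<And>e. e \<in> topspace E \<Longrightarrow> g e \<in> cvec N"
    using g unfolding fibre_linear_def by auto
  have pc: "continuous_map E X p" using cvb by (simp add: cvb_def)
  have pE: "p e \<in> topspace X" if "e \<in> topspace E" for e
    using that continuous_map_image_subset_topspace[OF pc] by auto
  have \<Theta>c: "continuous_map E E \<Theta>" using \<Theta> by (rule homeomorphic_imp_continuous_map)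
  have \<Theta>E: "\<Theta> ` topspace E = topspace E" using \<Theta> by (rule homeomorphic_imp_surjective_map)
  then have \<Theta>in: "\<Theta> e \<in> topspace E" if "e \<in> topspace E" for e using that by blast
  have g\<Theta>_cont: "continuous_map E euclidean (\<lambda>e. g (\<Theta> e))"
    using continuous_map_compose[OF \<Theta>c g_cont] by (simp add: o_def)
  define G where "G = quatern \<Theta> g"
  define \<phi> where "\<phi> x = G ` {e \<in> topspace E. p e = x}" for x
  \<comment> \<open>In even coordinates the signs and conjugations cancel; in odd ones the sign is
    absorbed by \<open>\<Theta>\<Theta>\<close>.\<close>
  have G\<Theta>: "G (\<Theta> e) = Qconj (G e)" if "e \<in> topspace E" for e
    using that g_sc[of e "-1"]
    by (auto simp: fun_eq_iff G_def quatern_def Qconj_apply \<Theta>\<Theta> elim!: oddE)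
  interpret fibrewise_embedding X K "2 * N" E p ad sc G \<phi>
  proof
    show "cvb X K E p ad sc" by (rule cvb)
    show "continuous_map E euclidean G"
      unfolding continuous_map_into_seq_iff
    proof
      fix i show "continuous_map E euclidean (\<lambda>e. G e i)"
        using g_cont g\<Theta>_cont
        by (cases "even i") (auto simp: G_def quatern_def continuous_map_into_seq_iff intro!: cmap_intros)
    qed
    show "G e \<in> cvec (2 * N)" if "e \<in> topspace E" for e
      using g_cv[OF that] g_cv[OF \<Theta>in[OF that]] by (auto simp: G_def quatern_def cvec_def)
    show "G (ad e f) = (\<lambda>i. G e i + G f i)" if "e \<in> topspace E" "f \<in> topspace E" "p e = p f" for e f
      using that by (auto simp: fun_eq_iff G_def quatern_def g_add \<Theta>_add \<Theta>in p\<Theta>)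
    \<comment> \<open>The conjugation in the odd coordinates undoes the antilinearity of
      \<open>\<Theta>\<close>.\<close>
    show "G (sc c e) = (\<lambda>i. c * G e i)" if "e \<in> topspace E" for c e
      using that by (auto simp: fun_eq_iff G_def quatern_def g_sc \<Theta>_sc \<Theta>in)
    show "e = f" if "e \<in> topspace E" "f \<in> topspace E" "p e = p f" "G e = G f" for e f
    proof -
      \<comment> \<open>The even coordinates alone are those of \<open>g\<close>, which is already
        injective on fibres.\<close>
      have "g e i = g f i" for i
        using fun_cong[OF that(4), of "2 * i"] by (simp add: G_def quatern_def)
      then show ?thesis using gi that pE unfolding fibre_inj_def by blast
    qed
    show "\<phi> x = G ` {e \<in> topspace E. p e = x}" for x by (simp add: \<phi>_def)
  qed
  have \<tau>\<tau>: "\<And>x. x \<in> topspace X \<Longrightarrow> \<tau> (\<tau> x) = x" using inv by (auto simp: involution_def)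
  have "\<phi> (\<tau> x) = rho (\<phi> x)" if x: "x \<in> topspace X" for x
  proof -
    have "{e \<in> topspace E. p e = \<tau> x} = \<Theta> ` {e \<in> topspace E. p e = x}"
    proof (intro equalityI subsetI)
      fix e assume e: "e \<in> {e \<in> topspace E. p e = \<tau> x}"
      then obtain f where f: "f \<in> topspace E" "e = \<Theta> f" using \<Theta>E by blast
      then have "\<tau> (p f) = \<tau> x" using e p\<Theta> by simp
      then have "p f = x" using \<tau>\<tau> pE f(1) x by metis
      then show "e \<in> \<Theta> ` {e \<in> topspace E. p e = x}" using f by blast
    qed (use \<Theta>in p\<Theta> in auto)
    then have "\<phi> (\<tau> x) = (\<lambda>e. G (\<Theta> e)) ` {e \<in> topspace E. p e = x}"
      by (simp add: \<phi>_def image_image)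
    also have "\<dots> = Qconj ` G ` {e \<in> topspace E. p e = x}"
      unfolding image_image by (rule image_cong) (use G\<Theta> in auto)
    finally show ?thesis by (simp add: \<phi>_def rho_def)
  qed
  then have "equivariant_grass X \<tau> K \<phi>"
    using \<phi>_cont by (simp add: equivariant_grass_def)
  moreover have "qiso E p ad sc \<Theta> (pb_top X \<phi>) fst pb_add pb_sc (pb_Theta \<tau>)"
    unfolding qiso_def
  proof (intro exI[of _ "\<lambda>e. (p e, G e)"] conjI allI ballI impI)
    have addE: "p (ad e f) = p e" if "e \<in> topspace E" "f \<in> topspace E" "p e = p f" for e f
      using cvb that by (simp add: cvb_def)
    have scE: "p (sc c e) = p e" if "e \<in> topspace E" for c e
      using cvb that by (simp add: cvb_def)
    show "(p (ad e f), G (ad e f)) = pb_add (p e, G e) (p f, G f)"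
      if "e \<in> topspace E" "f \<in> topspace E" "p e = p f" for e f
      using that addE G_add by (simp add: pb_add_def)
    show "(p (sc c e), G (sc c e)) = pb_sc c (p e, G e)" if "e \<in> topspace E" for c e
      using that scE G_sc by (simp add: pb_sc_def)
    show "(p (\<Theta> e), G (\<Theta> e)) = pb_Theta \<tau> (p e, G e)" if "e \<in> topspace E" for e
      using that p\<Theta> G\<Theta> by (simp add: pb_Theta_def)
  qed (simp_all add: homeo)
  ultimately show ?thesis by blast
qed

section \<open>Homotopic maps have isomorphic pull-backs\<close>

text \<open>Equations for the inverse are checked after applying \<open>g\<close>; \<open>qb\<close>
  guarantees that sums, multiples and \<open>\<Theta>\<close> stay in \<open>topspace E\<close>,
  where \<open>k\<close> cancels \<open>g\<close>.\<close>

lemma qiso_sym: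
  assumes qb: "qbundle X \<tau> K E p ad sc \<Theta>" and iso: "qiso E p ad sc \<Theta> E' p' ad' sc' \<Theta>'"
  shows "qiso E' p' ad' sc' \<Theta>' E p ad sc \<Theta>"
proof -
  obtain g where g: "homeomorphic_map E E' g"
    and gp: "\<forall>e\<in>topspace E. p' (g e) = p e"
    and ga: "\<forall>e\<in>topspace E. \<forall>f\<in>topspace E. p e = p f \<longrightarrow> g (ad e f) = ad' (g e) (g f)"
    and gs: "\<forall>c. \<forall>e\<in>topspace E. g (sc c e) = sc' c (g e)"
    and gT: "\<forall>e\<in>topspace E. g (\<Theta> e) = \<Theta>' (g e)"
    using iso unfolding qiso_def by (elim exE conjE)
  have adE: "ad e f \<in> topspace E" if "e \<in> topspace E" "f \<in> topspace E" "p e = p f" for e f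
    using qb that by (simp add: qbundle_def cvb_def)
  have scE: "sc c e \<in> topspace E" if "e \<in> topspace E" for c e
    using qb that by (simp add: qbundle_def cvb_def)
  have "homeomorphic_map E E \<Theta>" using qb by (simp add: qbundle_def)
  then have \<Theta>E: "\<Theta> e \<in> topspace E" if "e \<in> topspace E" for e
    using that homeomorphic_imp_surjective_map by blast
  obtain k where k: "homeomorphic_maps E E' g k" using g unfolding homeomorphic_map_maps by blast
  then have kg: "\<And>e. e \<in> topspace E \<Longrightarrow> k (g e) = e" and gk: "\<And>u. u \<in> topspace E' \<Longrightarrow> g (k u) = u"
    and kc: "continuous_map E' E k"
    unfolding homeomorphic_maps_def by auto
  have kE: "k u \<in> topspace E" if "u \<in> topspace E'" for u
    using that continuous_map_image_subset_topspace[OF kc] by auto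
  show ?thesis
    unfolding qiso_def
  proof (intro exI[of _ k] conjI ballI allI impI)
    show "homeomorphic_map E' E k"
      using k homeomorphic_maps_sym homeomorphic_maps_map by blast
    show kp: "p (k u) = p' u" if "u \<in> topspace E'" for u
      using gp kE[OF that] gk[OF that] by force
    show "k (ad' u v) = ad (k u) (k v)" if uv: "u \<in> topspace E'" "v \<in> topspace E'" "p' u = p' v" for u v
    proof -
      have "p (k u) = p (k v)" using kp uv by simp
      then have "g (ad (k u) (k v)) = ad' u v" using ga kE gk uv by simp
      then show ?thesis using kg adE[OF kE kE] uv \<open>p (k u) = p (k v)\<close> by metis
    qed
    show "k (sc' c u) = sc c (k u)" if "u \<in> topspace E'" for c u
      using gs kE[OF that] gk[OF that] kg[OF scE[OF kE[OF that]]] by metis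
    show "k (\<Theta>' u) = \<Theta> (k u)" if "u \<in> topspace E'" for u
      using gT kE[OF that] gk[OF that] kg[OF \<Theta>E[OF kE[OF that]]] by metis
  qed
qed

lemma qiso_trans:
  assumes "qiso E p ad sc \<Theta> E' p' ad' sc' \<Theta>'" "qiso E' p' ad' sc' \<Theta>' E'' p'' ad'' sc'' \<Theta>''"
  shows "qiso E p ad sc \<Theta> E'' p'' ad'' sc'' \<Theta>''"
proof -
  obtain g where g: "homeomorphic_map E E' g"
    and g': "\<forall>e\<in>topspace E. p' (g e) = p e"
     "\<forall>e\<in>topspace E. \<forall>f\<in>topspace E. p e = p f \<longrightarrow> g (ad e f) = ad' (g e) (g f)"
     "\<forall>c. \<forall>e\<in>topspace E. g (sc c e) = sc' c (g e)" "\<forall>e\<in>topspace E. g (\<Theta> e) = \<Theta>' (g e)"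
    using assms(1) unfolding qiso_def by (elim exE conjE)
  obtain h where h: "homeomorphic_map E' E'' h"
    and h': "\<forall>e\<in>topspace E'. p'' (h e) = p' e"
     "\<forall>e\<in>topspace E'. \<forall>f\<in>topspace E'. p' e = p' f \<longrightarrow> h (ad' e f) = ad'' (h e) (h f)"
     "\<forall>c. \<forall>e\<in>topspace E'. h (sc' c e) = sc'' c (h e)" "\<forall>e\<in>topspace E'. h (\<Theta>' e) = \<Theta>'' (h e)"
    using assms(2) unfolding qiso_def by (elim exE conjE)
  have gE: "\<And>e. e \<in> topspace E \<Longrightarrow> g e \<in> topspace E'"
    using homeomorphic_imp_surjective_map[OF g] by blast
  show ?thesis
    unfolding qiso_def
    by (intro exI[of _ "h \<circ> g"] conjI homeomorphic_map_compose[OF g h]) (use g' h' gE in auto)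
qed

lemma pb_top_cong:
  assumes "\<And>x. x \<in> topspace X \<Longrightarrow> \<phi> x = \<psi> x"
  shows "pb_top X \<phi> = pb_top X \<psi>"
proof -
  have "{(x, v). x \<in> topspace X \<and> v \<in> \<phi> x} = {(x, v). x \<in> topspace X \<and> v \<in> \<psi> x}"
    using assms by auto
  then show ?thesis by (simp add: pb_top_def)
qed

lemma grass_subset_eq:
  assumes "S \<in> grass_inf K" "T \<in> grass_inf K" "S \<subseteq> T"
  shows "S = T"
proof -
  obtain vs N where vs: "vs \<in> stiefel K N" "S = cspan K vs" using assms(1) by (rule grass_inf_obtain)
  obtain ws M where ws: "ws \<in> stiefel K M" "T = cspan K ws" using assms(2) by (rule grass_inf_obtain)
  have "vs j \<in> cspan K ws" if "j < K" for j
    using cspan_gen[OF that, of vs] assms(3) vs ws by blast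
  then show ?thesis using cspan_eqI[of K vs ws] vs ws by (simp add: stiefel_def)
qed

text \<open>The sum of the moduli of all entries of the difference of the two projection matrices on
  C^N: it bounds the operator norm for the l1 norm and is visibly continuous.\<close>

definition proj_dist :: "nat \<Rightarrow> (nat \<Rightarrow> complex) set \<Rightarrow> (nat \<Rightarrow> complex) set \<Rightarrow> real" where
  "proj_dist N S T = (\<Sum>k<N. \<Sum>i<N. cmod (proj S (unit_seq k) i - proj T (unit_seq k) i))"

text \<open>Such a \<open>v\<close> equals the difference of the two projections applied to
  \<open>v\<close>, whose l1 norm is at most \<open>proj_dist N S T\<close> times that of
  \<open>v\<close>; a factor below 1 forces \<open>v\<close> to be zero.\<close>

lemma proj_inj:
  assumes S: "S \<in> grass_inf K" "S \<subseteq> cvec N" and T: "T \<in> grass_inf K"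
    and d: "proj_dist N S T < 1" and v: "v \<in> S" "proj T v = (\<lambda>i. 0)"
  shows "v = (\<lambda>i. 0)"
proof -
  define a where "a k i = cmod (proj S (unit_seq k) i - proj T (unit_seq k) i)" for k i
  have vc: "v \<in> cvec N" using S v by blast
  have vi: "v i = (\<Sum>k<N. v k * (proj S (unit_seq k) i - proj T (unit_seq k) i))" for i
  proof -
    have "v i = proj S v i - proj T v i" using proj_id[OF S(1) v(1)] v(2) by simp
    also have "\<dots> = (\<Sum>k<N. v k * (proj S (unit_seq k) i - proj T (unit_seq k) i))"
      unfolding proj_expand[OF S(1) vc] proj_expand[OF T vc]
      by (simp add: sum_subtractf right_diff_distrib)
    finally show ?thesis .
  qed
  define s where "s = (\<Sum>i<N. cmod (v i))"
  have row: "(\<Sum>i<N. a k i) \<le> proj_dist N S T" if "k < N" for k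
    unfolding proj_dist_def a_def
    by (rule member_le_sum[of k "{..<N}"]) (use that in \<open>auto intro: sum_nonneg\<close>)
  have "s \<le> (\<Sum>i<N. \<Sum>k<N. cmod (v k) * a k i)"
    unfolding s_def
  proof (rule sum_mono)
    fix i assume "i \<in> {..<N}"
    have "cmod (v i) \<le> (\<Sum>k<N. cmod (v k * (proj S (unit_seq k) i - proj T (unit_seq k) i)))"
      by (subst vi) (rule norm_sum)
    then show "cmod (v i) \<le> (\<Sum>k<N. cmod (v k) * a k i)" by (simp add: a_def norm_mult)
  qed
  also have "\<dots> = (\<Sum>k<N. cmod (v k) * (\<Sum>i<N. a k i))"
    by (subst sum.swap) (simp add: sum_distrib_left)
  also have "\<dots> \<le> (\<Sum>k<N. cmod (v k) * proj_dist N S T)"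
    by (intro sum_mono mult_left_mono) (use row in auto)
  also have "\<dots> = s * proj_dist N S T" by (simp add: s_def sum_distrib_right)
  finally have "s * (1 - proj_dist N S T) \<le> 0" by (simp add: algebra_simps)
  moreover have "0 \<le> s" by (simp add: s_def sum_nonneg)
  ultimately have "s = 0" using d by (simp add: mult_le_0_iff)
  then have "\<forall>i<N. v i = 0" by (simp add: s_def sum_nonneg_eq_0_iff)
  then show ?thesis using vc by (auto simp: cvec_def fun_eq_iff intro: leI)
qed

lemma continuous_map_proj_joint:
  assumes \<psi>: "continuous_map Y (grass_top K) \<psi>" and v: "continuous_map Y euclidean v"
    and N: "\<And>y. y \<in> topspace Y \<Longrightarrow> v y \<in> cvec N"
  shows "continuous_map Y euclidean (\<lambda>y. proj (\<psi> y) (v y))"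
  unfolding continuous_map_into_seq_iff
proof
  fix i
  have "continuous_map Y euclidean (\<lambda>y. proj (\<psi> y) (unit_seq k))" for k
    using continuous_map_compose[OF \<psi> continuous_map_proj] by (simp add: o_def)
  then have "continuous_map Y euclidean (\<lambda>y. \<Sum>k<N. v y k * proj (\<psi> y) (unit_seq k) i)"
    using v by (auto simp: continuous_map_into_seq_iff intro!: cmap_intros)
  then show "continuous_map Y euclidean (\<lambda>y. proj (\<psi> y) (v y) i)"
  proof (rule continuous_map_eq)
    fix y assume y: "y \<in> topspace Y"
    then have "\<psi> y \<in> grass_inf K" using continuous_map_image_subset_topspace[OF \<psi>] by auto
    then show "(\<Sum>k<N. v y k * proj (\<psi> y) (unit_seq k) i) = proj (\<psi> y) (v y) i"
      using proj_expand[OF _ N[OF y]] by simp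
  qed
qed

lemma qiso_close:
  assumes \<tau>: "involution X \<tau>"
    and \<phi>: "equivariant_grass X \<tau> K \<phi>" "\<phi> ` topspace X \<subseteq> grass K N"
    and \<psi>: "equivariant_grass X \<tau> K \<psi>" "\<psi> ` topspace X \<subseteq> grass K N"
    and d: "\<And>x. x \<in> topspace X \<Longrightarrow> proj_dist N (\<phi> x) (\<psi> x) < 1"
  shows "qiso (pb_top X \<phi>) fst pb_add pb_sc (pb_Theta \<tau>) (pb_top X \<psi>) fst pb_add pb_sc (pb_Theta \<tau>)"
proof -
  have \<phi>c: "continuous_map X (grass_top K) \<phi>" and \<psi>c: "continuous_map X (grass_top K) \<psi>"
    and \<psi>r: "\<And>x. x \<in> topspace X \<Longrightarrow> \<psi> (\<tau> x) = rho (\<psi> x)"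
    using \<phi> \<psi> by (auto simp: equivariant_grass_def)
  have gi: "\<phi> x \<in> grass_inf K" "\<psi> x \<in> grass_inf K" if "x \<in> topspace X" for x
    using that continuous_map_image_subset_topspace[OF \<phi>c] continuous_map_image_subset_topspace[OF \<psi>c] by auto
  have cv: "\<forall>x\<in>topspace X. \<phi> x \<subseteq> cvec N" "\<forall>x\<in>topspace X. \<psi> x \<subseteq> cvec N"
    using \<phi>(2) \<psi>(2) grass_cvec by blast+
  note top [simp] = topspace_pb_top[OF cv(1)]
  define G where "G e = proj (\<psi> (fst e)) (snd e)" for e :: "'a \<times> (nat \<Rightarrow> complex)"
  define \<psi>' where "\<psi>' x = G ` {e \<in> topspace (pb_top X \<phi>). fst e = x}" for x
  have inj: "v = w" if x: "x \<in> topspace X" and vw: "v \<in> \<phi> x" "w \<in> \<phi> x" "proj (\<psi> x) v = proj (\<psi> x) w" for x v w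
  proof -
    have "proj (\<psi> x) (\<lambda>i. v i + (-1) * w i) = (\<lambda>i. 0)"
      using vw(3) proj_add[OF gi(2)[OF x], of v "\<lambda>i. (-1) * w i"] proj_scale[OF gi(2)[OF x], of "-1" w]
      by simp
    then have "(\<lambda>i. v i - w i) = (\<lambda>i. 0)"
      using proj_inj[OF gi(1)[OF x] _ gi(2)[OF x] d[OF x] grass_diff[OF gi(1)[OF x] vw(1,2)]] cv(1) x
      by simp
    then show ?thesis by (metis eq_iff_diff_eq_0 ext)
  qed
  interpret fibrewise_embedding X K N "pb_top X \<phi>" fst pb_add pb_sc G \<psi>'
  proof
    show "cvb X K (pb_top X \<phi>) fst pb_add pb_sc" by (rule pb_cvb[OF \<phi>c \<phi>(2)])
    have "continuous_map (pb_top X \<phi>) (grass_top K) (\<lambda>e. \<psi> (fst e))"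
      using continuous_map_compose[OF continuous_map_fst_pb_top[OF cv(1)] \<psi>c] by (simp add: o_def)
    then show "continuous_map (pb_top X \<phi>) euclidean G"
      unfolding G_def
      by (rule continuous_map_proj_joint[OF _ continuous_map_snd_pb_top[OF cv(1)], where N = N])
         (use subsetD[OF bspec[OF cv(1)]] in auto)
    show "G e \<in> cvec N" if "e \<in> topspace (pb_top X \<phi>)" for e
      using that subsetD[OF bspec[OF cv(2)] proj_in[OF gi(2)]] by (auto simp: G_def)
    show "G (pb_add e f) = (\<lambda>i. G e i + G f i)"
      if "e \<in> topspace (pb_top X \<phi>)" "f \<in> topspace (pb_top X \<phi>)" "fst e = fst f" for e f
      using that by (auto simp: G_def pb_add_def proj_add[OF gi(2)])
    show "G (pb_sc c e) = (\<lambda>i. c * G e i)" if "e \<in> topspace (pb_top X \<phi>)" for c e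
      using that by (auto simp: G_def pb_sc_def proj_scale[OF gi(2)])
    show "e = f" if "e \<in> topspace (pb_top X \<phi>)" "f \<in> topspace (pb_top X \<phi>)" "fst e = fst f" "G e = G f" for e f
      using that inj by (auto simp: G_def)
  qed (simp add: \<psi>'_def)
  \<comment> \<open>The projected fibre is only known to lie in \<open>\<psi> x\<close>; since both
    are \<open>K\<close>-dimensional, they coincide.\<close>
  have "\<psi>' x = \<psi> x" if x: "x \<in> topspace X" for x
  proof (rule grass_subset_eq)
    show "\<psi>' x \<in> grass_inf K" using \<phi>_stage x unfolding grass_inf_def by blast
    show "\<psi>' x \<subseteq> \<psi> x" using proj_in[OF gi(2)[OF x]] by (auto simp: \<psi>'_def G_def)
  qed (use gi x in blast)
  then have "pb_top X \<psi>' = pb_top X \<psi>" by (rule pb_top_cong)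
  then have "homeomorphic_map (pb_top X \<phi>) (pb_top X \<psi>) (\<lambda>e. (fst e, G e))" using homeo by simp
  moreover have "G (pb_Theta \<tau> e) = Qconj (G e)" if "e \<in> topspace (pb_top X \<phi>)" for e
  proof -
    have x: "fst e \<in> topspace X" using that by auto
    have "\<tau> (fst e) \<in> topspace X"
      using \<tau> x by (auto simp: involution_def continuous_map_def Pi_iff)
    \<comment> \<open>\<open>proj_rho\<close> asks that \<open>rho\<close> of the subspace be a
      plane of the Grassmannian again; it is the value of \<open>\<psi>\<close> at the image point
      under \<open>\<tau>\<close>.\<close>
    then have "rho (\<psi> (fst e)) \<in> grass_inf K" using gi(2) \<psi>r[OF x] by metis
    then show ?thesis
      using proj_rho[OF gi(2)[OF x]] \<psi>r[OF x] by (simp add: G_def pb_Theta_def)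
  qed
  ultimately show ?thesis
    unfolding qiso_def
    by (intro exI[of _ "\<lambda>e. (fst e, G e)"])
       (auto simp del: top simp: G_add G_sc, auto simp: pb_add_def pb_sc_def pb_Theta_def G_def)
qed

lemma homotopic_imp_qiso:
  assumes \<tau>: "involution X \<tau>" and X: "compact_space X"
    and hom: "homotopic_with (\<lambda>h. \<forall>x\<in>topspace X. h (\<tau> x) = rho (h x)) X (grass_top K) \<phi> \<psi>"
  shows "qiso (pb_top X \<phi>) fst pb_add pb_sc (pb_Theta \<tau>) (pb_top X \<psi>) fst pb_add pb_sc (pb_Theta \<tau>)"
proof -
  let ?I = "top_of_set {0..1::real}"
  obtain H where H: "continuous_map (prod_topology ?I X) (grass_top K) H"
    and H0: "\<forall>x. H (0, x) = \<phi> x" and H1: "\<forall>x. H (1, x) = \<psi> x"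
    and eq: "\<forall>t\<in>{0..1}. \<forall>x\<in>topspace X. H (t, \<tau> x) = rho (H (t, x))"
    using hom unfolding homotopic_with_def by (elim exE conjE)
  have cpt: "compact_space (prod_topology ?I X)"
    using X by (simp add: compact_space_prod_topology compact_space_subtopology)
  obtain M where M: "H ` topspace (prod_topology ?I X) \<subseteq> grass K (2 * M)"
    by (rule compact_image_in_stage[OF H cpt])
  define N where "N = 2 * M"
  have HN: "(\<lambda>x. H (t, x)) ` topspace X \<subseteq> grass K N" if "t \<in> {0..1}" for t
    using M that by (auto simp: N_def)
  have Heq: "equivariant_grass X \<tau> K (\<lambda>x. H (t, x))" if t: "t \<in> {0..1}" for t
  proof -
    have "continuous_map X (prod_topology ?I X) (\<lambda>x. (t, x))"
      using t by (simp add: continuous_map_pairwise o_def)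
    from continuous_map_compose[OF this H] show ?thesis
      using eq t by (simp add: equivariant_grass_def o_def)
  qed
  define R where "R s t \<longleftrightarrow> qiso (pb_top X (\<lambda>x. H (s, x))) fst pb_add pb_sc (pb_Theta \<tau>)
      (pb_top X (\<lambda>x. H (t, x))) fst pb_add pb_sc (pb_Theta \<tau>)" for s t
  \<comment> \<open>Each parameter is related to all parameters near it; symmetry and transitivity
    then relate any two points of the connected interval.\<close>
  have "R 0 1"
  proof (rule connected_equivalence_relation[of "{0..1::real}"])
    show "R t s" if "R s t" "s \<in> {0..1}" "t \<in> {0..1}" for s t
      using that qiso_sym[OF pb_qbundle[OF \<tau> Heq[OF that(2)] HN[OF that(2)]]] unfolding R_def by blast
    show "R s u" if "R s t" "R t u" for s t u
      using that qiso_trans unfolding R_def by blast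
    fix t0 :: real assume t0: "t0 \<in> {0..1}"
    have t0c: "continuous_map (prod_topology ?I X) (grass_top K) (\<lambda>q. H (t0, snd q))"
    proof -
      have "continuous_map (prod_topology ?I X) (prod_topology ?I X) (\<lambda>q. (t0, snd q))"
        using t0 by (simp add: continuous_map_pairwise o_def continuous_map_snd)
      from continuous_map_compose[OF this H] show ?thesis by (simp add: o_def)
    qed
    have pc: "continuous_map (prod_topology ?I X) euclidean (\<lambda>q. proj (F q) (unit_seq k) i)"
      if "continuous_map (prod_topology ?I X) (grass_top K) F" for F k i
      using continuous_map_compose[OF that continuous_map_proj[of K "unit_seq k"]]
      by (simp add: o_def continuous_map_into_seq_iff)
    have dc: "continuous_map (prod_topology ?I X) euclidean (\<lambda>q. proj_dist N (H (t0, snd q)) (H q))"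
      unfolding proj_dist_def
      using pc[OF t0c] pc[OF H]
      unfolding continuous_map_euclidean_iff
      by (intro ballI tendsto_sum tendsto_norm tendsto_diff) blast+
    define W where "W = {q \<in> topspace (prod_topology ?I X). proj_dist N (H (t0, snd q)) (H q) \<in> {..<1}}"
    have W: "openin (prod_topology ?I X) W"
      unfolding W_def by (rule openin_continuous_map_preimage[OF dc]) auto
    \<comment> \<open>At time \<open>t0\<close> the distance is zero, so the whole slice lies in
      \<open>W\<close>; compactness of \<open>X\<close> makes the admissible time neighbourhood
      uniform.\<close>
    have "{t0} \<times> topspace X \<subseteq> W" using t0 by (auto simp: W_def proj_dist_def)
    then obtain U V where UV: "openin ?I U" "t0 \<in> U" "topspace X \<subseteq> V" "U \<times> V \<subseteq> W"
      using tube_lemma_right[OF W, of "topspace X" t0] X t0 by (auto simp: compact_space_def)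
    have "R t0 t" if t: "t \<in> U" for t
    proof -
      have t01: "t \<in> {0..1}" using openin_subset[OF UV(1)] t by auto
      show ?thesis
        unfolding R_def
      proof (rule qiso_close[OF \<tau> Heq[OF t0] HN[OF t0] Heq[OF t01] HN[OF t01]])
        fix x assume "x \<in> topspace X"
        then have "(t, x) \<in> W" using UV t by blast
        then show "proj_dist N (H (t0, x)) (H (t, x)) < 1" by (simp add: W_def)
      qed
    qed
    then show "\<exists>T. openin ?I T \<and> t0 \<in> T \<and> (\<forall>t\<in>T. R t0 t)" using UV by blast
  qed auto
  moreover have "(\<lambda>x. H (0, x)) = \<phi>" "(\<lambda>x. H (1, x)) = \<psi>" using H0 H1 by auto
  ultimately show ?thesis by (simp add: R_def)
qed

section \<open>Isomorphic pull-backs come from homotopic maps\<close>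

definition shift :: "nat \<Rightarrow> (nat \<Rightarrow> complex) \<Rightarrow> nat \<Rightarrow> complex" where
  "shift M v i = (if i < M then 0 else v (i - M))"

text \<open>An even shift preserves the parity of indices, on which Q depends.\<close>

lemma Qconj_shift: "Qconj (shift (2 * M) v) = shift (2 * M) (Qconj v)"
proof
  fix i
  have "Suc i - 2 * M = Suc (i - 2 * M)" if "\<not> i < 2 * M" using that by (simp add: Suc_diff_le)
  moreover have "\<not> Suc i < 2 * M" if "\<not> i < 2 * M" using that by simp
  moreover have "Suc i < 2 * M" if "i < 2 * M" "even i" using that by presburger
  moreover have "\<not> i - 1 < 2 * M" "i - 1 - 2 * M = i - 2 * M - 1" if "\<not> i < 2 * M" "odd i"
    using that by presburger+
  moreover have "i - 1 < 2 * M" if "i < 2 * M" using that by simp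
  moreover have "even (i - 2 * M) = even i" if "\<not> i < 2 * M" using that by simp
  ultimately show "Qconj (shift (2 * M) v) i = shift (2 * M) (Qconj v) i"
    by (cases "i < 2 * M"; cases "even i") (simp_all add: Qconj_apply shift_def)
qed

text \<open>As \<open>v\<close> lies in the first \<open>M\<close> coordinates and \<open>shift M w\<close> in the following ones, the
  segment from \<open>v\<close> to \<open>shift M w\<close> avoids zero.\<close>
lemma segment_shift_zero:
  assumes "v \<in> cvec M" "(\<lambda>i. of_real (1 - t) * v i + of_real t * shift M w i) = (\<lambda>i. 0)"
  shows "t \<noteq> 1 \<Longrightarrow> v = (\<lambda>i. 0)" "t \<noteq> 0 \<Longrightarrow> w = (\<lambda>i. 0)"
proof -
  have z: "of_real (1 - t) * v i + of_real t * shift M w i = 0" for i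
    using fun_cong[OF assms(2), of i] by simp
  show "v = (\<lambda>i. 0)" if "t \<noteq> 1"
  proof
    fix i show "v i = 0"
    proof (cases "i < M")
      case True
      then have "of_real (1 - t) * v i = 0" using z[of i] by (simp add: shift_def)
      then have "1 - t = 0 \<or> v i = 0" by (simp only: mult_eq_0_iff of_real_eq_0_iff)
      then show ?thesis using that by simp
    next
      case False
      then show ?thesis using assms(1) by (simp add: cvec_def)
    qed
  qed
  show "w = (\<lambda>i. 0)" if "t \<noteq> 0"
  proof
    fix i show "w i = 0"
      using z[of "i + M"] assms(1) that by (simp add: shift_def cvec_def)
  qed
qed

text \<open>Without the shift, the segment from \<open>v\<close> to its image under the isomorphism
  could pass through zero. The pull-back of \<open>\<phi>\<close> to the cylinder is embedded by
  \<open>L\<close>, and its image planes form the homotopy, whose continuity is thus that of a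
  classifying map.\<close>

lemma qiso_imp_homotopic_shift:
  assumes \<tau>: "involution X \<tau>"
    and \<phi>: "equivariant_grass X \<tau> K \<phi>" "\<phi> ` topspace X \<subseteq> grass K (2 * M)"
    and \<psi>: "equivariant_grass X \<tau> K \<psi>" "\<psi> ` topspace X \<subseteq> grass K (2 * M)"
    and iso: "qiso (pb_top X \<phi>) fst pb_add pb_sc (pb_Theta \<tau>) (pb_top X \<psi>) fst pb_add pb_sc (pb_Theta \<tau>)"
  shows "homotopic_with (\<lambda>h. \<forall>x\<in>topspace X. h (\<tau> x) = rho (h x)) X (grass_top K)
           \<phi> (\<lambda>x. shift (2 * M) ` \<psi> x)"
proof -
  let ?I = "top_of_set {0..1::real}"
  let ?Y = "prod_topology ?I X"
  let ?\<Phi> = "\<lambda>q :: real \<times> 'a. \<phi> (snd q)"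
  have \<phi>c: "continuous_map X (grass_top K) \<phi>"
    and \<phi>r: "\<And>x. x \<in> topspace X \<Longrightarrow> \<phi> (\<tau> x) = rho (\<phi> x)"
    using \<phi> by (auto simp: equivariant_grass_def)
  have gi: "\<phi> x \<in> grass_inf K" if "x \<in> topspace X" for x
    using that continuous_map_image_subset_topspace[OF \<phi>c] by auto
  have cv: "\<forall>x\<in>topspace X. \<phi> x \<subseteq> cvec (2 * M)" "\<forall>x\<in>topspace X. \<psi> x \<subseteq> cvec (2 * M)"
    using \<phi>(2) \<psi>(2) grass_cvec by blast+
  note top = topspace_pb_top[OF cv(1)]
  obtain g where g: "homeomorphic_map (pb_top X \<phi>) (pb_top X \<psi>) g"
    and gp: "\<forall>e\<in>topspace (pb_top X \<phi>). fst (g e) = fst e"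
    and ga: "\<forall>e\<in>topspace (pb_top X \<phi>). \<forall>f\<in>topspace (pb_top X \<phi>). fst e = fst f \<longrightarrow>
        g (pb_add e f) = pb_add (g e) (g f)"
    and gs: "\<forall>c. \<forall>e\<in>topspace (pb_top X \<phi>). g (pb_sc c e) = pb_sc c (g e)"
    and gT: "\<forall>e\<in>topspace (pb_top X \<phi>). g (pb_Theta \<tau> e) = pb_Theta \<tau> (g e)"
    using iso unfolding qiso_def by (elim exE conjE)
  define f where "f x v = snd (g (x, v))" for x v
  have f_add: "f x (\<lambda>i. v i + w i) = (\<lambda>i. f x v i + f x w i)"
    if "x \<in> topspace X" "v \<in> \<phi> x" "w \<in> \<phi> x" for x v w
    using ga[rule_format, of "(x, v)" "(x, w)"] that by (simp add: top pb_add_def f_def)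
  have f_sc: "f x (\<lambda>i. c * v i) = (\<lambda>i. c * f x v i)"
    if "x \<in> topspace X" "v \<in> \<phi> x" for x v c
    using gs[rule_format, of "(x, v)" c] that by (simp add: top pb_sc_def f_def)
  have f_Q: "f (\<tau> x) (Qconj v) = Qconj (f x v)" if "x \<in> topspace X" "v \<in> \<phi> x" for x v
    using gT[rule_format, of "(x, v)"] that by (simp add: top pb_Theta_def f_def)
  have gxv: "g (x, v) = (x, f x v)" if "x \<in> topspace X" "v \<in> \<phi> x" for x v
    using gp[rule_format, of "(x, v)"] that by (simp add: top f_def prod_eq_iff)
  have f_inj: "v = w" if "x \<in> topspace X" "v \<in> \<phi> x" "w \<in> \<phi> x" "f x v = f x w" for x v w
  proof -
    have "g (x, v) = g (x, w)" using gxv that by simp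
    then show ?thesis
      using homeomorphic_imp_injective_map[OF g] that by (auto simp: inj_on_def top)
  qed
  have f_img: "f x ` \<phi> x = \<psi> x" if x: "x \<in> topspace X" for x
  proof (intro equalityI subsetI)
    fix w assume "w \<in> f x ` \<phi> x"
    then obtain v where v: "v \<in> \<phi> x" "w = f x v" by blast
    then have "g (x, v) \<in> topspace (pb_top X \<psi>)"
      using homeomorphic_imp_surjective_map[OF g] x by (auto simp: top)
    then show "w \<in> \<psi> x" using gxv[OF x v(1)] v(2) by (simp add: topspace_pb_top[OF cv(2)])
  next
    fix w assume "w \<in> \<psi> x"
    then have "(x, w) \<in> g ` topspace (pb_top X \<phi>)"
      using homeomorphic_imp_surjective_map[OF g] x by (simp add: topspace_pb_top[OF cv(2)])
    then obtain y v where "y \<in> topspace X" "v \<in> \<phi> y" "(x, w) = g (y, v)" by (auto simp: top)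
    then show "w \<in> f x ` \<phi> x" using gxv by auto
  qed
  have f_cv: "f x v \<in> cvec (2 * M)" if "x \<in> topspace X" "v \<in> \<phi> x" for x v
    using f_img cv(2) that by blast
  have sndg: "continuous_map (pb_top X \<phi>) euclidean (\<lambda>e. snd (g e))"
    using continuous_map_compose[OF homeomorphic_imp_continuous_map[OF g] continuous_map_snd_pb_top[OF cv(2)]]
    by (simp add: o_def)
  define L where "L = (\<lambda>((t, x), v) i. of_real (1 - t) * v i + of_real t * shift (2 * M) (f x v) i)"
  have \<Phi>c: "continuous_map ?Y (grass_top K) ?\<Phi>"
    using continuous_map_compose[OF continuous_map_snd \<phi>c] by (simp add: o_def)
  have \<Phi>N: "?\<Phi> ` topspace ?Y \<subseteq> grass K (2 * M)" using \<phi>(2) by auto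
  have cvY: "\<forall>q\<in>topspace ?Y. ?\<Phi> q \<subseteq> cvec (2 * M)" using cv(1) by auto
  note topY = topspace_pb_top[OF cvY]
  let ?E = "pb_top ?Y ?\<Phi>"
  \<comment> \<open>The plane at \<open>(t, x)\<close> is the image of \<open>\<phi> x\<close> under
    the interpolating map at time \<open>t\<close>.\<close>
  define H where "H q = L ` {e \<in> topspace ?E. fst e = q}" for q
  interpret fibrewise_embedding ?Y K "2 * M + 2 * M" ?E fst pb_add pb_sc L H
  proof
    show "cvb ?Y K ?E fst pb_add pb_sc" by (rule pb_cvb[OF \<Phi>c \<Phi>N])
    have c1: "continuous_map ?E ?Y fst" and c2: "continuous_map ?E euclidean snd"
      using continuous_map_fst_pb_top[OF cvY] continuous_map_snd_pb_top[OF cvY] .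
    have "continuous_map ?E ?I (\<lambda>e. fst (fst e))"
      using continuous_map_compose[OF c1 continuous_map_fst] by (simp add: o_def)
    then have ct: "continuous_map ?E euclidean (\<lambda>e. fst (fst e))"
      by (simp add: continuous_map_in_subtopology)
    have cx: "continuous_map ?E X (\<lambda>e. snd (fst e))"
      using continuous_map_compose[OF c1 continuous_map_snd] by (simp add: o_def)
    have "continuous_map ?E (pb_top X \<phi>) (\<lambda>e. (snd (fst e), snd e))"
      unfolding continuous_map_into_pb_top[OF cv(1)] using cx c2 by (auto simp: topY)
    from continuous_map_compose[OF this sndg]
    have cf: "continuous_map ?E euclidean (\<lambda>e. f (snd (fst e)) (snd e))"
      by (simp add: o_def f_def)
    have c1t: "continuous_map ?E euclidean (\<lambda>e. 1 - fst (fst e))"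
      using ct by (auto simp: continuous_map_euclidean_iff intro!: tendsto_intros)
    show "continuous_map ?E euclidean L"
      unfolding continuous_map_into_seq_iff
    proof
      fix i
      have "continuous_map ?E euclidean (\<lambda>e. shift (2 * M) (f (snd (fst e)) (snd e)) i)"
        using cf by (cases "i < 2 * M") (auto simp: shift_def continuous_map_into_seq_iff)
      moreover have "continuous_map ?E euclidean (\<lambda>e. snd e i)"
        using c2 by (simp add: continuous_map_into_seq_iff)
      ultimately show "continuous_map ?E euclidean (\<lambda>e. L e i)"
        unfolding L_def split_beta
        by (intro continuous_map_add_complex continuous_map_mult_complex
            continuous_map_of_real[OF ct] continuous_map_of_real[OF c1t])
    qed
    show "L e \<in> cvec (2 * M + 2 * M)" if e_in: "e \<in> topspace ?E" for e
    proof -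
      obtain t x v where e: "e = ((t, x), v)" "x \<in> topspace X" "v \<in> \<phi> x"
        using e_in by (auto simp: topY)
      have "v \<in> cvec (2 * M)" "f x v \<in> cvec (2 * M)" using e cv(1) f_cv by auto
      then show ?thesis by (auto simp: e L_def cvec_def shift_def)
    qed
    show "L (pb_add e e') = (\<lambda>i. L e i + L e' i)"
      if "e \<in> topspace ?E" "e' \<in> topspace ?E" "fst e = fst e'" for e e'
      using that by (auto simp: topY L_def pb_add_def f_add shift_def algebra_simps fun_eq_iff)
    show "L (pb_sc c e) = (\<lambda>i. c * L e i)" if "e \<in> topspace ?E" for c e
      using that by (auto simp: topY L_def pb_sc_def f_sc shift_def algebra_simps fun_eq_iff)
    show "e = e'" if ee: "e \<in> topspace ?E" "e' \<in> topspace ?E" "fst e = fst e'" "L e = L e'" for e e'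
    proof -
      obtain t x v v' where e: "e = ((t, x), v)" "e' = ((t, x), v')"
        and x: "x \<in> topspace X" and v: "v \<in> \<phi> x" "v' \<in> \<phi> x"
        using ee(1-3) by (auto simp: topY)
      \<comment> \<open>By linearity of \<open>f x\<close>, injectivity on a fibre reduces to a
        trivial kernel.\<close>
      let ?d = "\<lambda>i. v i - v' i"
      have d: "?d \<in> \<phi> x" using grass_diff[OF gi[OF x] v] .
      have "f x ?d = f x (\<lambda>i. v i + (-1) * v' i)" by simp
      also have "\<dots> = (\<lambda>i. f x v i - f x v' i)"
        using f_add[OF x v(1) grass_scale[OF gi[OF x] v(2), of "-1"]] f_sc[OF x v(2), of "-1"] by simp
      finally have fd: "f x ?d = (\<lambda>i. f x v i - f x v' i)" .
      have z: "(\<lambda>i. of_real (1 - t) * ?d i + of_real t * shift (2 * M) (f x ?d) i) = (\<lambda>i. 0)"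
      proof
        fix i show "of_real (1 - t) * ?d i + of_real t * shift (2 * M) (f x ?d) i = 0"
          using fun_cong[OF ee(4), of i]
          by (auto simp: e L_def fd shift_def algebra_simps)
      qed
      have dc: "?d \<in> cvec (2 * M)" using d cv(1) x by blast
      \<comment> \<open>Before time 1 the first block still determines the vector; at time 1 only
        the shifted block is left, and injectivity of \<open>f x\<close> takes over.\<close>
      have "?d = (\<lambda>i. 0)"
      proof (cases "t = 1")
        case True
        then have "f x ?d = (\<lambda>i. 0)" using segment_shift_zero(2)[OF dc z] by simp
        moreover have "f x (\<lambda>i. 0) = (\<lambda>i. 0)" using f_sc[OF x d, of 0] by simp
        ultimately show ?thesis using f_inj[OF x d grass_zero[OF gi[OF x]]] by simp
      next
        case False
        then show ?thesis using segment_shift_zero(1)[OF dc z] by simp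
      qed
      then have "v = v'" by (metis eq_iff_diff_eq_0 ext)
      then show ?thesis by (simp add: e)
    qed
  qed (simp add: H_def)
  have H_eq: "H (t, x) = (\<lambda>v. L ((t, x), v)) ` \<phi> x" if "t \<in> {0..1}" "x \<in> topspace X" for t x
    using that by (auto simp: H_def topY image_iff)
  have \<tau>X: "\<tau> x \<in> topspace X" if "x \<in> topspace X" for x
    using \<tau> that by (auto simp: involution_def continuous_map_def Pi_iff)
  have LQ: "L ((t, \<tau> x), Qconj v) = Qconj (L ((t, x), v))"
    if "x \<in> topspace X" "v \<in> \<phi> x" for t x v
  proof -
    have "Qconj (L ((t, x), v)) = (\<lambda>i. of_real (1 - t) * Qconj v i
        + of_real t * Qconj (shift (2 * M) (f x v)) i)"
      using Qconj_add[of "\<lambda>i. of_real (1 - t) * v i" "\<lambda>i. of_real t * shift (2 * M) (f x v) i"]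
        Qconj_scale[of "of_real (1 - t)" v] Qconj_scale[of "of_real t" "shift (2 * M) (f x v)"]
      by (simp add: L_def)
    then show ?thesis using f_Q[OF that] by (simp add: L_def Qconj_shift)
  qed
  have H_rho: "H (t, \<tau> x) = rho (H (t, x))" if t: "t \<in> {0..1}" and x: "x \<in> topspace X" for t x
  proof -
    have "H (t, \<tau> x) = (\<lambda>v. L ((t, \<tau> x), Qconj v)) ` \<phi> x"
      using H_eq[OF t \<tau>X[OF x]] \<phi>r[OF x] by (simp add: rho_def image_image)
    also have "\<dots> = (\<lambda>v. Qconj (L ((t, x), v))) ` \<phi> x"
      by (rule image_cong) (use LQ[OF x] in auto)
    finally show ?thesis using H_eq[OF t x] by (simp add: rho_def image_image)
  qed
  show ?thesis
  proof (subst homotopic_with)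
    show "(\<forall>x\<in>topspace X. h (\<tau> x) = rho (h x)) = (\<forall>x\<in>topspace X. k (\<tau> x) = rho (k x))"
      if "\<And>x. x \<in> topspace X \<Longrightarrow> h x = k x" for h k
      using that \<tau>X by simp
    have "H (0, x) = \<phi> x" if "x \<in> topspace X" for x
      using H_eq[of 0 x] that by (simp add: L_def)
    moreover have "H (1, x) = shift (2 * M) ` \<psi> x" if "x \<in> topspace X" for x
    proof -
      have "H (1, x) = (\<lambda>v. shift (2 * M) (f x v)) ` \<phi> x" using H_eq[of 1 x] that by (simp add: L_def)
      also have "\<dots> = shift (2 * M) ` f x ` \<phi> x" by (simp add: image_image)
      finally show ?thesis using f_img[OF that] by simp
    qed
    \<comment> \<open>\<open>\<phi>_cont\<close> is the fact of the interpretation and speaks of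
      \<open>H\<close>.\<close>
    ultimately show "\<exists>h. continuous_map ?Y (grass_top K) h \<and> (\<forall>x\<in>topspace X. h (0, x) = \<phi> x) \<and>
        (\<forall>x\<in>topspace X. h (1, x) = shift (2 * M) ` \<psi> x) \<and>
        (\<forall>t\<in>{0..1}. \<forall>x\<in>topspace X. h (t, \<tau> x) = rho (h (t, x)))"
      using \<phi>_cont H_rho by (intro exI[of _ H]) simp
  qed
qed

lemma qiso_imp_homotopic:
  assumes \<tau>: "involution X \<tau>" and X: "compact_space X"
    and \<phi>: "equivariant_grass X \<tau> K \<phi>" and \<psi>: "equivariant_grass X \<tau> K \<psi>"
    and iso: "qiso (pb_top X \<phi>) fst pb_add pb_sc (pb_Theta \<tau>) (pb_top X \<psi>) fst pb_add pb_sc (pb_Theta \<tau>)"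
  shows "homotopic_with (\<lambda>h. \<forall>x\<in>topspace X. h (\<tau> x) = rho (h x)) X (grass_top K) \<phi> \<psi>"
proof -
  obtain M1 where M1: "\<phi> ` topspace X \<subseteq> grass K (2 * M1)"
    using compact_image_in_stage[of X K \<phi>] \<phi> X by (auto simp: equivariant_grass_def)
  obtain M2 where M2: "\<psi> ` topspace X \<subseteq> grass K (2 * M2)"
    using compact_image_in_stage[of X K \<psi>] \<psi> X by (auto simp: equivariant_grass_def)
  \<comment> \<open>A common stage gives both homotopies the same shift, hence the same end
    map.\<close>
  define M where "M = max M1 M2"
  have M: "\<phi> ` topspace X \<subseteq> grass K (2 * M)" "\<psi> ` topspace X \<subseteq> grass K (2 * M)"
    using M1 M2 grass_mono[of "2 * M1" "2 * M" K] grass_mono[of "2 * M2" "2 * M" K]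
    by (auto simp: M_def)
  have "qiso (pb_top X \<psi>) fst pb_add pb_sc (pb_Theta \<tau>) (pb_top X \<psi>) fst pb_add pb_sc (pb_Theta \<tau>)"
    unfolding qiso_def by (intro exI[of _ "\<lambda>e. e"]) (auto simp: homeomorphic_map_id[unfolded id_def])
  from qiso_imp_homotopic_shift[OF \<tau> \<psi> M(2) \<psi> M(2) this]
    qiso_imp_homotopic_shift[OF \<tau> \<phi> M(1) \<psi> M(2) iso]
  show ?thesis by (meson homotopic_with_symD homotopic_with_trans)
qed

text \<open>The bijection is expressed without forming quotient sets: pull-back is defined on
  equivariant maps, hits every isomorphism class, and identifies two maps exactly when they are
  equivariantly homotopic. Total spaces of bundles may live in any type \<open>'e\<close>.\<close>

theorem mainTheorem7:
  fixes X :: "'a topology" and \<tau> :: "'a \<Rightarrow> 'a" and m :: nat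
  assumes "involution X \<tau>"
    and "compact_space X" and "path_connected_space X" and "Hausdorff_space X"
    and "has_Z2_CW_structure X \<tau>"
  shows
    \<comment> \<open>the pull-back along an equivariant map is a rank 2m Q-bundle\<close>
    "(\<forall>\<phi>. equivariant_grass X \<tau> (2*m) \<phi> \<longrightarrow>
        qbundle X \<tau> (2*m) (pb_top X \<phi>) fst pb_add pb_sc (pb_Theta \<tau>))
     \<and>
     \<comment> \<open>every rank 2m Q-bundle is isomorphic to such a pull-back (surjectivity)\<close>
     (\<forall>(E :: 'e topology) p add sc \<Theta>. qbundle X \<tau> (2*m) E p add sc \<Theta> \<longrightarrow>
        (\<exists>\<phi>. equivariant_grass X \<tau> (2*m) \<phi> \<and>
           qiso E p add sc \<Theta> (pb_top X \<phi>) fst pb_add pb_sc (pb_Theta \<tau>)))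
     \<and>
     \<comment> \<open>pull-backs are isomorphic iff the maps are equivariantly homotopic
         (well-definedness and injectivity)\<close>
     (\<forall>\<phi> \<psi>. equivariant_grass X \<tau> (2*m) \<phi> \<longrightarrow> equivariant_grass X \<tau> (2*m) \<psi> \<longrightarrow>
        (qiso (pb_top X \<phi>) fst pb_add pb_sc (pb_Theta \<tau>) (pb_top X \<psi>) fst pb_add pb_sc (pb_Theta \<tau>)
         \<longleftrightarrow> homotopic_with (\<lambda>h. \<forall>x\<in>topspace X. h (\<tau> x) = rho (h x))
                X (grass_top (2*m)) \<phi> \<psi>))"
proof (intro conjI allI impI)
  fix \<phi> assume \<phi>: "equivariant_grass X \<tau> (2*m) \<phi>"
  obtain M where "\<phi> ` topspace X \<subseteq> grass (2*m) (2*M)"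
    using compact_image_in_stage[of X "2*m" \<phi>] \<phi> assms(2) by (auto simp: equivariant_grass_def)
  then show "qbundle X \<tau> (2*m) (pb_top X \<phi>) fst pb_add pb_sc (pb_Theta \<tau>)"
    by (rule pb_qbundle[OF assms(1) \<phi>])
next
  fix E :: "'e topology" and p ad sc \<Theta> assume "qbundle X \<tau> (2*m) E p ad sc \<Theta>"
  then show "\<exists>\<phi>. equivariant_grass X \<tau> (2*m) \<phi> \<and>
      qiso E p ad sc \<Theta> (pb_top X \<phi>) fst pb_add pb_sc (pb_Theta \<tau>)"
    by (rule qbundle_is_pullback[OF assms(2,4)])
next
  fix \<phi> \<psi> assume "equivariant_grass X \<tau> (2*m) \<phi>" "equivariant_grass X \<tau> (2*m) \<psi>"
  then show "qiso (pb_top X \<phi>) fst pb_add pb_sc (pb_Theta \<tau>) (pb_top X \<psi>) fst pb_add pb_sc (pb_Theta \<tau>)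
         \<longleftrightarrow> homotopic_with (\<lambda>h. \<forall>x\<in>topspace X. h (\<tau> x) = rho (h x))
                X (grass_top (2*m)) \<phi> \<psi>"
    using qiso_imp_homotopic[OF assms(1,2)] homotopic_imp_qiso[OF assms(1,2)] by blast
qed

end
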